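(* Let $C>0$ and $0<\varepsilon_g<1/2$ be given constants. Let $\xi_1,\dots,\xi_n$ be i.i.d. copies of a subgaussian random variable with mean zero and variance one. Assume $x,y\in I_W$ satisfy $|x-y|\ge N^{\varepsilon_g}$. Then for $\delta=N^{-C}$ and any open ball $B(a,\delta)\subset\mathbb R^4$, \[\mathbb P\Big(\tfrac1{\sqrt N}S_n(x,y,\xi)\in B(a,\delta)\Big)=O(\delta^4),\qquad S_n(x,y,\xi)=\sum_{i=1}^n\xi_i\big(b_i(x),c_i(x),b_i(y),c_i(y)\big).\]
   Context: Let $0<c_1<c_2$ be constants, $n$ large and $M$ a large parameter with $I_W:=[c_1M,c_2M]\subset[0,\sqrt n-M]$; set $N:=M$. For $x>0$, $b_i(x)=\sqrt N e^{-x^2/2}x^i/\sqrt{i!}$ and $c_i(x)=b_i'(x)=\sqrt N e^{-x^2/2}\frac{i-x^2}{x}\frac{x^i}{\sqrt{i!}}$. Implied constants may depend on $C,\varepsilon_g,c_1,c_2$ and the law of $\xi$. *)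

theory Defs
  imports "HOL-Probability.Probability"
begin

definition bfun :: "real \<Rightarrow> nat \<Rightarrow> real \<Rightarrow> real" where
  "bfun N i x = sqrt N * exp (- (x^2) / 2) * x ^ i / sqrt (fact i)"

text \<open>c_i(x) = b_i'(x) = sqrt N e^{-x^2/2} ((i - x^2)/x) x^i / sqrt(i!)\<close>
definition cfun :: "real \<Rightarrow> nat \<Rightarrow> real \<Rightarrow> real" where
  "cfun N i x = sqrt N * exp (- (x^2) / 2) * ((real i - x^2) / x) * x ^ i / sqrt (fact i)"

definition Sn :: "real \<Rightarrow> nat \<Rightarrow> real \<Rightarrow> real \<Rightarrow> (nat \<Rightarrow> real) \<Rightarrow> real ^ 4" where
  "Sn N n x y \<omega> = (\<Sum>i=1..n. \<omega> i *\<^sub>R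
      (vector [bfun N i x, cfun N i x, bfun N i y, cfun N i y] :: real ^ 4))"

definition subgaussian :: "real measure \<Rightarrow> bool" where
  "subgaussian \<mu> \<longleftrightarrow> (\<exists>K>0. \<forall>t\<ge>0. measure \<mu> {z \<in> space \<mu>. \<bar>z\<bar> \<ge> t} \<le> 2 * exp (- (t^2) / K^2))"

end

theory Submission
  imports Defs "HOL-Complex_Analysis.Complex_Analysis" "HOL-Real_Asymp.Real_Asymp"
begin

text \<open>The law of \<open>\<xi>\<close> enters only through its characteristic function \<open>\<phi>\<close>. With
  \<open>D s = 1 - \<bar>\<phi> s\<bar>\<^sup>2\<close>, averaging characters against a Gaussian bounds the probability by a constant
  times the mean of \<open>exp (- \<Sum>\<^sub>i D (f i) / 2)\<close>, where \<open>f i\<close> is the linear form with frequency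
  \<open>t = g / \<delta>\<close> and \<open>g\<close> is a standard normal vector. It is thus enough that \<open>\<Sum>\<^sub>i D (f i)\<close> is at least
  \<open>c min (\<bar>t\<bar>\<^sup>2) M\<close> for \<open>t\<close> of polynomial size.

  The function \<open>D\<close> is a squared \<open>L\<^sup>2\<close> norm of \<open>1 - exp (i s z)\<close>, so \<open>D (s - t) \<le> 2 D s + 2 D t\<close>, and
  the sum of \<open>D\<close> along a progression \<open>i, i + h, \<dots>, i + k h\<close> controls \<open>D\<close> of the \<open>k\<close>-th difference of
  step \<open>h\<close>. Near \<open>i = x\<^sup>2\<close> the terms in \<open>y\<close> are negligible and \<open>f\<close> is, at scale \<open>x\<close>, close in all
  derivatives to \<open>exp (- u\<^sup>2 / 4) (p + q u)\<close>, whose \<open>k\<close>-th derivative does not vanish at \<open>0\<close> if the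
  parity of \<open>k\<close> is adapted to \<open>(p, q)\<close>. For large fixed \<open>k\<close> the step \<open>h\<close> can then be tuned so that
  the difference falls into the range where \<open>D s\<close> is bounded below by a multiple of \<open>s\<^sup>2\<close>.\<close>

section \<open>Iterated differences\<close>

text \<open>The function is differenced first and the iteration follows, so an induction on
  \<open>k\<close> can pass to the new function with \<open>f\<close> arbitrary and the base point
  unchanged.\<close>

fun fdiff :: "'a::ab_group_add \<Rightarrow> nat \<Rightarrow> ('a \<Rightarrow> real) \<Rightarrow> 'a \<Rightarrow> real" where
  "fdiff h 0 f v = f v"
| "fdiff h (Suc k) f v = fdiff h k (\<lambda>v. f (v + h) - f v) v"

lemma fdiff_add: "fdiff h k (\<lambda>v. f v + g v) v = fdiff h k f v + fdiff h k g v"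
proof (induction k arbitrary: f g)
  case (Suc k)
  have "(\<lambda>v. f (v + h) + g (v + h) - (f v + g v)) = (\<lambda>v. (f (v + h) - f v) + (g (v + h) - g v))"
    by (simp add: fun_eq_iff)
  then show ?case by (simp add: Suc)
qed simp

lemma fdiff_cmult: "fdiff h k (\<lambda>v. c * f v) v = c * fdiff h k f v"
proof (induction k arbitrary: f)
  case (Suc k)
  have "(\<lambda>v. c * f (v + h) - c * f v) = (\<lambda>v. c * (f (v + h) - f v))"
    by (simp add: fun_eq_iff algebra_simps)
  then show ?case by (simp add: Suc)
qed simp

lemma abs_fdiff_le:
  fixes v h :: real
  assumes "\<And>j. j \<le> k \<Longrightarrow> \<bar>f (v + real j * h)\<bar> \<le> B"
  shows "\<bar>fdiff h k f v\<bar> \<le> 2 ^ k * B"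
  using assms
proof (induction k arbitrary: f B)
  case 0
  then show ?case using "0"[of 0] by simp
next
  case (Suc k)
  have "\<bar>fdiff h k (\<lambda>v. f (v + h) - f v) v\<bar> \<le> 2 ^ k * (2 * B)"
  proof (rule Suc.IH)
    fix j assume "j \<le> k"
    then show "\<bar>f (v + real j * h + h) - f (v + real j * h)\<bar> \<le> 2 * B"
      using Suc.prems[of "Suc j"] Suc.prems[of j] by (simp add: algebra_simps)
  qed
  then show ?case by (simp add: mult_ac)
qed

text \<open>One differencing bounds \<open>D\<close> by twice its values at two neighbouring points,
  and every point of the progression occurs in at most two such pairs; each order of difference
  therefore costs a factor 4.\<close>

lemma quasi_square_fdiff_le:
  fixes D :: "real \<Rightarrow> real" and v h :: real
  assumes nonneg: "\<And>s. 0 \<le> D s" and sub: "\<And>s t. D (s - t) \<le> 2 * D s + 2 * D t"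
  shows "D (fdiff h k f v) \<le> 4 ^ k * (\<Sum>j\<le>k. D (f (v + real j * h)))"
proof (induction k arbitrary: f)
  case (Suc k)
  let ?g = "\<lambda>j. D (f (v + real j * h))"
  have "D (fdiff h (Suc k) f v) \<le> 4 ^ k * (\<Sum>j\<le>k. D (f (v + real j * h + h) - f (v + real j * h)))"
    using Suc by simp
  also have "(\<Sum>j\<le>k. D (f (v + real j * h + h) - f (v + real j * h))) \<le> (\<Sum>j\<le>k. 2 * ?g (Suc j) + 2 * ?g j)"
  proof (rule sum_mono)
    fix j
    have "v + real j * h + h = v + real (Suc j) * h"
      by (simp add: algebra_simps)
    then show "D (f (v + real j * h + h) - f (v + real j * h)) \<le> 2 * ?g (Suc j) + 2 * ?g j"
      using sub by metis
  qed
  also have "\<dots> = 2 * (\<Sum>j\<le>k. ?g (Suc j)) + 2 * (\<Sum>j\<le>k. ?g j)"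
    by (simp add: sum.distrib sum_distrib_left)
  also have "\<dots> \<le> 2 * (\<Sum>j\<le>Suc k. ?g j) + 2 * (\<Sum>j\<le>Suc k. ?g j)"
  proof (intro add_mono mult_left_mono)
    show "(\<Sum>j\<le>k. ?g (Suc j)) \<le> (\<Sum>j\<le>Suc k. ?g j)"
      using sum.atMost_Suc_shift[of ?g k] nonneg by simp
    show "(\<Sum>j\<le>k. ?g j) \<le> (\<Sum>j\<le>Suc k. ?g j)"
      using nonneg by simp
  qed auto
  finally show ?case by (simp add: algebra_simps)
qed simp

text \<open>\<open>F m\<close> plays the \<open>m\<close>-th derivative of \<open>F 0\<close>. The
  induction passes to the family of first differences \<open>F m (w + h) - F m w\<close>; by the
  mean value theorem its top member is \<open>h\<close> times a value of the old top
  derivative.\<close>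

lemma fdiff_approx:
  fixes v h :: real and F :: "nat \<Rightarrow> real \<Rightarrow> real"
  assumes "h \<ge> 0"
    and "\<And>m w. m < k \<Longrightarrow> v \<le> w \<Longrightarrow> w \<le> v + real k * h \<Longrightarrow> (F m has_real_derivative F (Suc m) w) (at w)"
    and "\<And>w. v \<le> w \<Longrightarrow> w \<le> v + real k * h \<Longrightarrow> \<bar>F k w - A\<bar> \<le> B"
  shows "\<bar>fdiff h k (F 0) v - h ^ k * A\<bar> \<le> h ^ k * B"
  using assms(2,3)
proof (induction k arbitrary: F A B)
  case (Suc k)
  let ?F = "\<lambda>m w. F m (w + h) - F m w"
  have *: "w \<le> v + real (Suc k) * h" "w + h \<le> v + real (Suc k) * h" "v \<le> w + h"
    if "v \<le> w" "w \<le> v + real k * h" for w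
    using that \<open>h \<ge> 0\<close> by (auto simp: algebra_simps)
  have "\<bar>fdiff h k (?F 0) v - h ^ k * (h * A)\<bar> \<le> h ^ k * (h * B)"
  proof (rule Suc.IH)
    fix m w assume m: "m < k" and w: "v \<le> w" "w \<le> v + real k * h"
    have "(F m has_real_derivative F (Suc m) (w + h)) (at (w + h))"
      "(F m has_real_derivative F (Suc m) w) (at w)"
      using Suc.prems(1) m w *[OF w] by auto
    then show "(?F m has_real_derivative ?F (Suc m) w) (at w)"
      by (intro DERIV_diff) (auto simp: DERIV_shift)
  next
    fix w assume w: "v \<le> w" "w \<le> v + real k * h"
    show "\<bar>?F k w - h * A\<bar> \<le> h * B"
    proof (cases "h = 0")
      case False
      then have "h > 0" using \<open>h \<ge> 0\<close> by simp
      then obtain z where z: "w < z" "z < w + h" "F k (w + h) - F k w = (w + h - w) * F (Suc k) z"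
        using MVT2[of w "w + h" "F k" "F (Suc k)"] Suc.prems(1)[of k] w *[OF w] by (auto simp: algebra_simps)
      have "?F k w - h * A = h * (F (Suc k) z - A)"
        using z by (simp add: algebra_simps)
      moreover have "\<bar>F (Suc k) z - A\<bar> \<le> B"
        using Suc.prems(2)[of z] z w *[OF w] by simp
      ultimately show ?thesis
        using \<open>h > 0\<close> by (simp add: abs_mult)
    qed simp
  qed
  then show ?case by (simp add: mult_ac)
qed simp

lemma fdiff_cong:
  fixes v h :: real
  assumes "\<And>j. j \<le> k \<Longrightarrow> f (v + real j * h) = g (v + real j * h)"
  shows "fdiff h k f v = fdiff h k g v"
  using assms
proof (induction k arbitrary: f g)
  case 0
  then show ?case using "0"[of 0] by simp
next
  case (Suc k)
  have "fdiff h k (\<lambda>v. f (v + h) - f v) v = fdiff h k (\<lambda>v. g (v + h) - g v) v"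
  proof (rule Suc.IH)
    fix j assume "j \<le> k"
    then show "f (v + real j * h + h) - f (v + real j * h) = g (v + real j * h + h) - g (v + real j * h)"
      using Suc.prems[of "Suc j"] Suc.prems[of j] by (simp add: algebra_simps)
  qed
  then show ?case by simp
qed

section \<open>Interpolated Poisson weights\<close>

lemma ln_Gamma_plus1_real: "z > 0 \<Longrightarrow> ln_Gamma (z + 1) = ln_Gamma z + ln (z::real)"
proof -
  assume z: "z > 0"
  then have "z \<notin> \<int>\<^sub>\<le>\<^sub>0"
    by (auto elim!: nonpos_Ints_cases)
  then show ?thesis
    using z Gamma_plus1[of z] by (simp add: ln_Gamma_real_pos ln_mult_pos)
qed

text \<open>The mean value theorem on \<open>[z, z + 1]\<close> and the functional equation of Gamma
  give a point where \<open>Digamma\<close> equals \<open>ln z\<close>; monotonicity carries this to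
  both ends of the interval.\<close>

lemma Digamma_plus1_bounds:
  assumes "(z::real) > 0"
  shows "ln z \<le> Digamma (z + 1)" "Digamma (z + 1) \<le> ln z + 1 / z"
proof -
  have "\<exists>w. z < w \<and> w < z + 1 \<and> ln_Gamma (z + 1) - ln_Gamma z = (z + 1 - z) * Digamma w"
    using assms by (intro MVT2 has_field_derivative_ln_Gamma_real) auto
  then obtain w where w: "z < w" "w < z + 1" "Digamma w = ln z"
    using ln_Gamma_plus1_real[OF assms] by auto
  then show "ln z \<le> Digamma (z + 1)"
    using Digamma_real_mono[of w "z + 1"] assms by simp
  show "Digamma (z + 1) \<le> ln z + 1 / z"
    using Digamma_real_mono[of z w] Digamma_plus1[of z] w assms by simp
qed

text \<open>Halving the error term makes the Stirling bound below lose only \<open>ln z / 2\<close>,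
  which is the true power of \<open>x\<close> in the weight at its mean. The gap \<open>d\<close>
  decreases along \<open>z, z + 1, ...\<close> by the trapezoid rule for \<open>1 / t\<close>, and
  its lower bound from the cruder estimate tends to 0.\<close>

lemma Digamma_plus1_le:
  assumes "(z::real) > 0"
  shows "Digamma (z + 1) \<le> ln z + 1 / (2 * z)"
proof -
  define d where "d = (\<lambda>z::real. ln z + 1 / (2 * z) - Digamma (z + 1))"
  have step: "d (w + 1) \<le> d w" if "w > 0" for w
  proof -
    define a b where "a = 1 / w" and "b = 1 / (w + 1)"
    have "ln (w + 1) - ln w \<le> (a + b) / 2"
      using ln_inverse_approx_le[of w 1] that by (simp add: inverse_eq_divide a_def b_def)
    moreover have "Digamma (w + 1 + 1) = Digamma (w + 1) + b"
      unfolding b_def using that by (intro Digamma_plus1) simp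
    moreover have "p + b / 2 - c' \<le> q + a / 2 - c" if "p - q \<le> (a + b) / 2" "c' = c + b" for p q c c' :: real
      using that by (simp add: field_simps)
    ultimately have "ln (w + 1) + b / 2 - Digamma (w + 1 + 1) \<le> ln w + a / 2 - Digamma (w + 1)"
      by blast
    moreover have "d (w + 1) = ln (w + 1) + b / 2 - Digamma (w + 1 + 1)" "d w = ln w + a / 2 - Digamma (w + 1)"
      by (simp_all add: d_def a_def b_def)
    ultimately show ?thesis by simp
  qed
  have "d (z + real n) \<le> d z" for n
  proof (induction n)
    case (Suc n)
    show ?case using step[of "z + real n"] Suc assms by (simp add: add_ac)
  qed simp
  moreover have "- 1 / (2 * (z + real n)) \<le> d (z + real n)" for n
    using Digamma_plus1_bounds(2)[of "z + real n"] assms by (simp add: d_def field_simps)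
  ultimately have "- 1 / (2 * (z + real n)) \<le> d z" for n
    using order_trans by blast
  moreover have "(\<lambda>n. - 1 / (2 * (z + real n))) \<longlonglongrightarrow> 0"
    by real_asymp
  ultimately have "0 \<le> d z"
    by (meson LIMSEQ_le_const2)
  then show ?thesis by (simp add: d_def)
qed

text \<open>The two digamma bounds are integrated from 1, where
  \<open>ln_Gamma 2 = 0\<close>.\<close>

lemma ln_Gamma_plus1_bounds:
  assumes "(z::real) \<ge> 1"
  shows "z * ln z - z \<le> ln_Gamma (z + 1)" "ln_Gamma (z + 1) \<le> z * ln z - z + ln z / 2 + 1"
proof -
  have "ln_Gamma (1 + 1) - (1 * ln 1 - 1) \<le> ln_Gamma (z + 1) - (z * ln z - z)"
  proof (rule DERIV_nonneg_imp_nondecreasing[OF assms])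
    fix w :: real assume "1 \<le> w" "w \<le> z"
    then show "\<exists>y. ((\<lambda>z. ln_Gamma (z + 1) - (z * ln z - z)) has_real_derivative y) (at w) \<and> 0 \<le> y"
      using Digamma_plus1_bounds[of w]
      by (intro exI[of _ "Digamma (w + 1) - ln w"]) (auto intro!: derivative_eq_intros)
  qed
  then show "z * ln z - z \<le> ln_Gamma (z + 1)"
    using ln_Gamma_real_conv_fact[of 2] by simp
  have "(1 * ln 1 - 1 + ln 1 / 2) - ln_Gamma (1 + 1) \<le> (z * ln z - z + ln z / 2) - ln_Gamma (z + 1)"
  proof (rule DERIV_nonneg_imp_nondecreasing[OF assms])
    fix w :: real assume "1 \<le> w" "w \<le> z"
    then show "\<exists>y. ((\<lambda>z. (z * ln z - z + ln z / 2) - ln_Gamma (z + 1)) has_real_derivative y) (at w) \<and> 0 \<le> y"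
      using Digamma_plus1_le[of w]
      by (intro exI[of _ "ln w + 1 / (2 * w) - Digamma (w + 1)"])
        (auto intro!: derivative_eq_intros)
  qed
  then show "ln_Gamma (z + 1) \<le> z * ln z - z + ln z / 2 + 1"
    using ln_Gamma_real_conv_fact[of 2] by simp
qed

text \<open>The trigamma series is compared term by term with a telescoping series of sum
  \<open>1 / z\<close>. The differences are of third order and dominated by a real telescoping
  series of sum \<open>1 / \<rho>^2\<close>.\<close>

lemma norm_Polygamma_1_minus_inverse_le:
  fixes z :: complex
  assumes "0 < \<rho>" "\<rho> \<le> Re z"
  shows "norm (Polygamma 1 z - 1 / z) \<le> 1 / \<rho>\<^sup>2"
proof -
  have nz: "z + of_nat k \<noteq> 0" for k
    using assms by (auto simp: complex_eq_iff)
  have nz': "z + of_nat k + 1 \<noteq> 0" for k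
    using nz[of "Suc k"] by (simp add: add_ac)
  have lower: "\<rho> + real k \<le> norm (z + of_nat k)" for k
    using complex_Re_le_cmod[of "z + of_nat k"] assms by simp
  have tele: "(\<lambda>k. 1 / (z + of_nat k) - 1 / (z + of_nat (Suc k))) sums (1 / (z + of_nat 0) - 0)"
    unfolding divide_inverse mult_1_left
    by (intro telescope_sums'[OF filterlim_compose[OF tendsto_inverse_0]]
              tendsto_add_filterlim_at_infinity[OF tendsto_const] tendsto_of_nat)
  have tele_real: "(\<lambda>k. 1 / (\<rho> + real k) - 1 / (\<rho> + real (Suc k))) sums (1 / (\<rho> + real 0) - 0)"
    by (intro telescope_sums') real_asymp
  have "(\<lambda>k. inverse ((z + of_nat k) ^ Suc 1)) sums (\<Sum>k. inverse ((z + of_nat k) ^ Suc 1))"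
    using Polygamma_converges'[of z "Suc 1"] nz[of 0] by (intro summable_sums) auto
  then have "(\<lambda>k. inverse ((z + of_nat k)\<^sup>2)) sums Polygamma 1 z"
    by (simp add: Polygamma_def power2_eq_square)
  from sums_diff[OF this tele]
  have s: "(\<lambda>k. inverse ((z + of_nat k)\<^sup>2) - (1 / (z + of_nat k) - 1 / (z + of_nat (Suc k))))
      sums (Polygamma 1 z - 1 / z)"
    by simp
  have b: "norm (inverse ((z + of_nat k)\<^sup>2) - (1 / (z + of_nat k) - 1 / (z + of_nat (Suc k))))
      \<le> 1 / \<rho> * (1 / (\<rho> + real k) - 1 / (\<rho> + real (Suc k)))" for k
  proof -
    have "inverse ((z + of_nat k)\<^sup>2) - (1 / (z + of_nat k) - 1 / (z + of_nat (Suc k)))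
        = 1 / ((z + of_nat k)\<^sup>2 * (z + of_nat (Suc k)))"
    proof -
      have "inverse (a\<^sup>2) - (1 / a - 1 / (a + 1)) = 1 / (a\<^sup>2 * (a + 1))"
        if "a \<noteq> 0" "a + 1 \<noteq> 0" for a :: complex
        using that by (simp add: divide_simps power2_eq_square)
      from this[OF nz[of k] nz'[of k]] show ?thesis
        by (simp add: add_ac)
    qed
    also have "norm \<dots> = 1 / ((norm (z + of_nat k))\<^sup>2 * norm (z + of_nat (Suc k)))"
      by (simp only: norm_divide norm_mult norm_power norm_one)
    also have "\<dots> \<le> 1 / ((\<rho> * (\<rho> + real k)) * (\<rho> + real (Suc k)))"
    proof (intro divide_left_mono mult_mono)
      show "\<rho> * (\<rho> + real k) \<le> (norm (z + of_nat k))\<^sup>2"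
        unfolding power2_eq_square using lower[of k] assms by (intro mult_mono) auto
      show "\<rho> + real (Suc k) \<le> norm (z + of_nat (Suc k))" by (rule lower)
      have "norm (z + of_nat k) > 0" "norm (z + of_nat (Suc k)) > 0"
        using nz zero_less_norm_iff by blast+
      then show "0 < (norm (z + of_nat k))\<^sup>2 * norm (z + of_nat (Suc k)) * (\<rho> * (\<rho> + real k) * (\<rho> + real (Suc k)))"
        using assms by (intro mult_pos_pos zero_less_power) auto
    qed (use assms in auto)
    also have "\<dots> = 1 / \<rho> * (1 / (\<rho> + real k) - 1 / (\<rho> + real (Suc k)))"
      using assms by (simp add: field_simps)
    finally show ?thesis .
  qed
  have t: "(\<lambda>k. 1 / \<rho> * (1 / (\<rho> + real k) - 1 / (\<rho> + real (Suc k)))) sums (1 / \<rho> * (1 / \<rho>))"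
    using sums_mult[OF tele_real, of "1 / \<rho>"] by simp
  have "norm (Polygamma 1 z - 1 / z) \<le> 1 / \<rho> * (1 / \<rho>)"
    using norm_sums_le[OF s t b] by simp
  then show ?thesis by (simp add: power2_eq_square)
qed

text \<open>The derivatives of \<open>exp (- u^2 / 4)\<close>, generated by a recursion of Hermite
  type from which their values at 0 can be read off.\<close>

fun gauss_deriv :: "nat \<Rightarrow> complex \<Rightarrow> complex" where
  "gauss_deriv 0 u = exp (- u\<^sup>2 / 4)"
| "gauss_deriv (Suc 0) u = - u / 2 * exp (- u\<^sup>2 / 4)"
| "gauss_deriv (Suc (Suc m)) u = - u / 2 * gauss_deriv (Suc m) u - of_nat (Suc m) / 2 * gauss_deriv m u"

lemma has_field_derivative_gauss_deriv:
  "(gauss_deriv m has_field_derivative gauss_deriv (Suc m) u) (at u)"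
proof (induction m u rule: gauss_deriv.induct)
  case (1 u)
  have "gauss_deriv 0 = (\<lambda>u. exp (- u\<^sup>2 / 4))"
    by (rule ext) simp
  then show ?case
    by (auto intro!: derivative_eq_intros)
next
  case (2 u)
  have "gauss_deriv (Suc 0) = (\<lambda>u. - u / 2 * exp (- u\<^sup>2 / 4))"
    by (rule ext) simp
  then show ?case
    by (auto intro!: derivative_eq_intros simp: field_simps)
next
  case (3 m u)
  have f: "gauss_deriv (Suc (Suc m)) = (\<lambda>u. - u / 2 * gauss_deriv (Suc m) u - of_nat (Suc m) / 2 * gauss_deriv m u)"
    by (rule ext) simp
  have d: "((\<lambda>u. - u / 2 * gauss_deriv (Suc m) u - of_nat (Suc m) / 2 * gauss_deriv m u)
      has_field_derivative (- 1 / 2) * gauss_deriv (Suc m) u + gauss_deriv (Suc (Suc m)) u * (- u / 2)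
        - of_nat (Suc m) / 2 * gauss_deriv (Suc m) u) (at u)"
    by (intro DERIV_diff DERIV_mult DERIV_cmult 3) (auto intro!: derivative_eq_intros)
  have e: "(- 1 / 2) * gauss_deriv (Suc m) u + gauss_deriv (Suc (Suc m)) u * (- u / 2)
        - of_nat (Suc m) / 2 * gauss_deriv (Suc m) u = gauss_deriv (Suc (Suc (Suc m))) u"
    unfolding gauss_deriv.simps(3)[of "Suc m"] by (simp add: field_simps del: gauss_deriv.simps)
  from d show ?case unfolding e f[symmetric] .
qed

text \<open>At 0 the recursion keeps only the term two orders below, with a nonzero factor, so
  orders 0 and 1 decide.\<close>

lemma gauss_deriv_0_eq_0_iff: "gauss_deriv m 0 = 0 \<longleftrightarrow> odd m"
proof (induction m rule: induct_nat_012)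
  case (ge2 m)
  have "of_nat (Suc m) \<noteq> (0::complex)"
    by (rule of_nat_neq_0)
  then show ?case
    using ge2 by (simp del: of_nat_Suc)
qed simp_all

text \<open>\<open>u * exp (- u^2 / 4)\<close> is \<open>-2\<close> times the first derivative of
  the Gaussian, so the factor \<open>q * u\<close> amounts to one further derivative.\<close>

lemma higher_deriv_gauss_comb:
  "(deriv ^^ k) (\<lambda>u. (p + q * u) * exp (- u\<^sup>2 / 4)) = (\<lambda>u. p * gauss_deriv k u - 2 * q * gauss_deriv (Suc k) u)"
proof (induction k)
  case 0
  have "p * exp (- u\<^sup>2 / 4) - 2 * q * (- u / 2 * exp (- u\<^sup>2 / 4)) = (p + q * u) * exp (- u\<^sup>2 / 4)" for u
    by (simp add: distrib_right)
  then show ?case by (simp add: fun_eq_iff)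
next
  case (Suc k)
  have d: "((\<lambda>u. p * gauss_deriv k u - 2 * q * gauss_deriv (Suc k) u) has_field_derivative
      p * gauss_deriv (Suc k) u - 2 * q * gauss_deriv (Suc (Suc k)) u) (at u)" for u
    by (intro DERIV_diff DERIV_cmult has_field_derivative_gauss_deriv)
  show ?case
    unfolding funpow.simps o_apply Suc.IH by (intro ext DERIV_imp_deriv d)
qed

text \<open>\<open>poisson_root x z\<close> interpolates the square roots of the Poisson weights with mean \<open>x\<^sup>2\<close>, and
  \<open>poisson_ratio x u\<close> is its value at \<open>z = x\<^sup>2 + x u\<close> relative to the one at \<open>z = x\<^sup>2\<close>.\<close>

definition poisson_root :: "real \<Rightarrow> real \<Rightarrow> real" where
  "poisson_root x z = exp (- x\<^sup>2 / 2 + z * ln x - ln_Gamma (z + 1) / 2)"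

definition poisson_ratio :: "real \<Rightarrow> complex \<Rightarrow> complex" where
  "poisson_ratio x u = exp (of_real (x * ln x) * u
     - (ln_Gamma (of_real (x\<^sup>2 + 1) + of_real x * u) - ln_Gamma (of_real (x\<^sup>2 + 1))) / 2)"

lemma poisson_root_nat:
  assumes "x > 0"
  shows "poisson_root x (real i) = exp (- (x\<^sup>2) / 2) * x ^ i / sqrt (fact i)"
proof -
  have "poisson_root x (real i) = exp (- (x\<^sup>2) / 2) * exp (real i * ln x) / exp (ln_Gamma (real i + 1) / 2)"
    by (simp only: poisson_root_def exp_diff exp_add)
  also have "ln_Gamma (real i + 1) / 2 = ln (sqrt (fact i))"
    using ln_Gamma_real_conv_fact[of "Suc i"] by (simp add: add_ac ln_sqrt)
  also have "exp (real i * ln x) = x ^ i"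
    using assms by (simp add: exp_of_nat_mult)
  finally show ?thesis by simp
qed

text \<open>Stirling at \<open>z = x^2\<close>: there \<open>z * ln z\<close> equals
  \<open>2 * x^2 * ln x\<close> and the main terms cancel, leaving at most
  \<open>ln x / 2 + 1 / 2\<close> in the exponent.\<close>

lemma poisson_root_mean_bounds:
  assumes "x \<ge> 1"
  shows "poisson_root x (x\<^sup>2) \<le> 1" "exp (- 1 / 2) / sqrt x \<le> poisson_root x (x\<^sup>2)"
proof -
  have "x\<^sup>2 \<ge> 1" using assms by simp
  have "x\<^sup>2 * ln (x\<^sup>2) = 2 * (x\<^sup>2 * ln x)" using assms by (simp add: ln_realpow)
  note b = ln_Gamma_plus1_bounds[OF \<open>x\<^sup>2 \<ge> 1\<close>, unfolded this]
  show "poisson_root x (x\<^sup>2) \<le> 1"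
    using b by (simp add: poisson_root_def)
  have "exp (- 1 / 2) / sqrt x = exp (- 1 / 2 - ln x / 2)"
  proof -
    have "exp (ln x / 2) = sqrt x"
      using exp_ln[of "sqrt x"] assms by (simp add: ln_sqrt)
    then show ?thesis by (simp add: exp_diff)
  qed
  also have "\<dots> \<le> poisson_root x (x\<^sup>2)"
    using b assms by (simp add: poisson_root_def ln_realpow)
  finally show "exp (- 1 / 2) / sqrt x \<le> poisson_root x (x\<^sup>2)" .
qed

lemma poisson_root_eq_ratio:
  assumes "x > 0" "x\<^sup>2 + 1 + x * u > 0"
  shows "of_real (poisson_root x (x\<^sup>2 + x * u)) = of_real (poisson_root x (x\<^sup>2)) * poisson_ratio x (of_real u)"
proof -
  have "ln_Gamma (complex_of_real (x\<^sup>2 + 1) + of_real x * of_real u) = of_real (ln_Gamma (x\<^sup>2 + x * u + 1))"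
    using assms(2) ln_Gamma_complex_of_real[of "x\<^sup>2 + 1 + x * u"] by (simp add: add_ac)
  moreover have "ln_Gamma (complex_of_real (x\<^sup>2 + 1)) = of_real (ln_Gamma (x\<^sup>2 + 1))"
    by (intro ln_Gamma_complex_of_real) (simp add: add_nonneg_pos)
  ultimately have "poisson_ratio x (of_real u) =
      of_real (exp (x * ln x * u - (ln_Gamma (x\<^sup>2 + x * u + 1) - ln_Gamma (x\<^sup>2 + 1)) / 2))"
    unfolding poisson_ratio_def exp_of_real[symmetric] by simp
  moreover have "poisson_root x (x\<^sup>2 + x * u) = poisson_root x (x\<^sup>2) *
      exp (x * ln x * u - (ln_Gamma (x\<^sup>2 + x * u + 1) - ln_Gamma (x\<^sup>2 + 1)) / 2)"
    unfolding poisson_root_def exp_add[symmetric]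
    by (rule arg_cong[where f = exp]) (simp add: field_simps)
  ultimately show ?thesis by (simp only: of_real_mult)
qed

lemma poisson_ratio_holomorphic:
  assumes "x > 0"
  shows "poisson_ratio x holomorphic_on {u. - x < Re u}"
proof -
  have dom: "complex_of_real (x\<^sup>2 + 1) + of_real x * u \<notin> \<real>\<^sub>\<le>\<^sub>0" if "- x < Re u" for u
  proof -
    have "- (x * x) < x * Re u"
      using mult_strict_left_mono[OF that assms] by simp
    then show ?thesis by (simp add: complex_nonpos_Reals_iff power2_eq_square)
  qed
  have "(ln_Gamma \<circ> (\<lambda>u. complex_of_real (x\<^sup>2 + 1) + of_real x * u)) holomorphic_on {u. - x < Re u}"
  proof (rule holomorphic_on_compose_gen)
    show "ln_Gamma holomorphic_on - \<real>\<^sub>\<le>\<^sub>0"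
      by (rule holomorphic_ln_Gamma) simp
  qed (use dom in \<open>auto intro!: holomorphic_intros\<close>)
  then have "(\<lambda>u. ln_Gamma (complex_of_real (x\<^sup>2 + 1) + of_real x * u)) holomorphic_on {u. - x < Re u}"
    by (simp only: o_def)
  then show ?thesis
    unfolding poisson_ratio_def
    by (intro holomorphic_on_exp' holomorphic_on_diff holomorphic_on_mult holomorphic_on_divide
        holomorphic_on_const holomorphic_on_ident) auto
qed

text \<open>The second derivative of the logarithm of the ratio is \<open>- x^2 / 2\<close> times
  trigamma near \<open>x^2\<close>, hence \<open>-1/2\<close> up to order \<open>1 / x\<close>, and
  its first derivative at 0 is of order \<open>1 / x\<close> by the digamma bounds. Integrating
  twice over the unit disc compares the logarithm with \<open>- u^2 / 4\<close>.\<close>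

lemma norm_poisson_ratio_minus_gauss_le:
  assumes x: "x \<ge> 2" and u: "norm u \<le> 1"
  shows "norm (poisson_ratio x u - exp (- u\<^sup>2 / 4)) \<le> 4 * exp 3 / x"
proof -
  define z where "z = (\<lambda>u. complex_of_real (x\<^sup>2 + 1) + of_real x * u)"
  \<comment> \<open>\<open>R\<close> is the exponent of the ratio minus that of the Gaussian;
    \<open>R1\<close> and \<open>R2\<close> are its first two derivatives.\<close>
  define R where "R = (\<lambda>u. of_real (x * ln x) * u - (ln_Gamma (z u) - ln_Gamma (of_real (x\<^sup>2 + 1))) / 2 + u\<^sup>2 / 4)"
  define R1 where "R1 = (\<lambda>u. of_real (x * ln x) - of_real x / 2 * Digamma (z u) + u / 2)"
  define R2 where "R2 = (\<lambda>u. - (of_real x)\<^sup>2 / 2 * Polygamma 1 (z u) + 1 / 2)"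
  \<comment> \<open>The least real part of \<open>z\<close> on the unit disc, still of order
    \<open>x^2\<close>.\<close>
  define \<rho> where "\<rho> = x\<^sup>2 + 1 - x"
  have \<rho>: "\<rho> \<ge> x\<^sup>2 / 2" "\<rho> > 0"
  proof -
    have "0 \<le> (x - 1)\<^sup>2" by simp
    then show "\<rho> \<ge> x\<^sup>2 / 2" by (simp add: \<rho>_def power2_diff)
    moreover have "x\<^sup>2 / 2 > 0" using x by simp
    ultimately show "\<rho> > 0" by linarith
  qed
  have Re_z: "\<rho> \<le> Re (z v)" if "v \<in> cball 0 1" for v
  proof -
    have "\<bar>Re v\<bar> \<le> 1" using that abs_Re_le_cmod[of v] by simp
    then have "x * (- 1) \<le> x * Re v"
      using x by (intro mult_left_mono) auto
    then show ?thesis by (simp add: z_def \<rho>_def)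
  qed
  have z_dom: "z v \<notin> \<real>\<^sub>\<le>\<^sub>0" "z v \<notin> \<int>\<^sub>\<le>\<^sub>0" "z v \<noteq> 0" if "v \<in> cball 0 1" for v
    using Re_z[OF that] \<rho> by (auto simp: complex_nonpos_Reals_iff elim!: nonpos_Ints_cases)
  have dz: "(z has_field_derivative of_real x) (at v within A)" for v A
    unfolding z_def by (auto intro!: derivative_eq_intros)
  have dsq: "((\<lambda>u::complex. u\<^sup>2 / 4) has_field_derivative v / 2) (at v within A)" for v A
    by (auto intro!: derivative_eq_intros)
  have dR: "(R has_field_derivative R1 v) (at v within cball 0 1)" if "v \<in> cball 0 1" for v
  proof -
    have lg: "((\<lambda>u. ln_Gamma (z u)) has_field_derivative Digamma (z v) * of_real x) (at v within cball 0 1)"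
      by (rule DERIV_chain2[OF has_field_derivative_ln_Gamma_complex[OF z_dom(1)[OF that]] dz])
    have "(R has_field_derivative of_real (x * ln x) - (Digamma (z v) * of_real x - 0) / 2 + v / 2) (at v within cball 0 1)"
      unfolding R_def
      by (intro DERIV_add DERIV_diff DERIV_cdivide DERIV_cmult_Id DERIV_const lg dsq)
    then show ?thesis
      by (simp add: R1_def mult.commute)
  qed
  have dR1: "(R1 has_field_derivative R2 v) (at v within cball 0 1)" if "v \<in> cball 0 1" for v
  proof -
    have dg: "((\<lambda>u. Digamma (z u)) has_field_derivative Polygamma (Suc 0) (z v) * of_real x) (at v within cball 0 1)"
      by (rule DERIV_chain2[OF has_field_derivative_Polygamma[OF z_dom(2)[OF that]] dz])
    have "(R1 has_field_derivative 0 - of_real x / 2 * (Polygamma (Suc 0) (z v) * of_real x) + 1 / 2) (at v within cball 0 1)"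
      unfolding R1_def
      by (intro DERIV_add DERIV_diff DERIV_cdivide DERIV_cmult DERIV_ident DERIV_const dg)
    then show ?thesis
      by (simp add: R2_def power2_eq_square mult_ac)
  qed
  have R2_bound: "norm (R2 v) \<le> 3 / x" if v: "v \<in> cball 0 1" for v
  proof -
    \<comment> \<open>Trigamma is split into \<open>1 / z\<close> and an error. The main part
      \<open>1 / 2 - x^2 / (2 * z)\<close> is small because \<open>z v\<close> differs from
      \<open>x^2\<close> only by \<open>1 + x * v\<close>.\<close>
    have "R2 v = - (of_real x)\<^sup>2 / 2 * (Polygamma 1 (z v) - 1 / z v) + (1 / 2 - (of_real x)\<^sup>2 / 2 * (1 / z v))"
      using z_dom(3)[OF v] by (simp add: R2_def field_simps)
    also have "1 / 2 - (of_real x)\<^sup>2 / 2 * (1 / z v) = (1 + of_real x * v) / (2 * z v)"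
    proof -
      have "1 / 2 - (of_real x)\<^sup>2 / 2 * (1 / z v) = (z v - (of_real x)\<^sup>2) / (2 * z v)"
        using z_dom(3)[OF v] by (simp add: diff_divide_distrib)
      also have "z v - (of_real x)\<^sup>2 = 1 + of_real x * v"
        by (simp add: z_def)
      finally show ?thesis .
    qed
    finally have "norm (R2 v) \<le> norm (- (of_real x)\<^sup>2 / 2 * (Polygamma 1 (z v) - 1 / z v)) + norm ((1 + of_real x * v) / (2 * z v))"
      by (metis norm_triangle_ineq)
    also have "norm (- (of_real x)\<^sup>2 / 2 * (Polygamma 1 (z v) - 1 / z v)) \<le> x\<^sup>2 / 2 * (1 / \<rho>\<^sup>2)"
      using mult_left_mono[OF norm_Polygamma_1_minus_inverse_le[OF \<rho>(2) Re_z[OF v]], of "x\<^sup>2 / 2"]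
      by (simp add: norm_mult norm_divide norm_power)
    also have "norm ((1 + of_real x * v) / (2 * z v)) \<le> (1 + x) / (2 * \<rho>)"
    proof -
      have "norm (1 + of_real x * v) \<le> 1 + x"
      proof -
        have "x * norm v \<le> x * 1"
          using v x by (intro mult_left_mono) auto
        moreover have "norm (of_real x * v) = x * norm v"
          using x by (simp add: norm_mult)
        ultimately show ?thesis
          using norm_triangle_ineq[of 1 "of_real x * v"] by simp
      qed
      moreover have "\<rho> \<le> norm (z v)"
        using Re_z[OF v] complex_Re_le_cmod[of "z v"] by linarith
      ultimately show ?thesis
        unfolding norm_divide using \<rho> x by (intro frac_le) (auto simp: norm_mult)
    qed
    also have "x\<^sup>2 / 2 * (1 / \<rho>\<^sup>2) + (1 + x) / (2 * \<rho>) \<le> x\<^sup>2 / 2 * (1 / (x\<^sup>2 / 2)\<^sup>2) + (1 + x) / (2 * (x\<^sup>2 / 2))"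
      using \<rho> x by (intro add_mono mult_left_mono divide_left_mono power_mono mult_pos_pos) auto
    also have "\<dots> = (3 + x) / x\<^sup>2"
      using x by (simp add: field_simps power2_eq_square)
    also have "\<dots> \<le> 3 / x"
      using x by (simp add: field_simps power2_eq_square)
    finally show ?thesis by simp
  qed
  have R1_0: "norm (R1 0) \<le> 1 / x"
  proof -
    have pos: "x\<^sup>2 > 0" "x\<^sup>2 + 1 > 0" using x by (auto intro: add_pos_pos)
    have "Digamma (complex_of_real (x\<^sup>2 + 1)) = of_real (Digamma (x\<^sup>2 + 1))"
      using pos by (intro Polygamma_of_real) simp
    then have "R1 0 = of_real (x * ln x - x / 2 * Digamma (x\<^sup>2 + 1))"
      by (simp add: R1_def z_def)
    moreover have "x * ln x \<le> x / 2 * Digamma (x\<^sup>2 + 1)"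
      using mult_left_mono[OF Digamma_plus1_bounds(1)[OF pos(1)], of "x / 2"] x by (simp add: ln_realpow)
    moreover have "x / 2 * Digamma (x\<^sup>2 + 1) \<le> x * ln x + x / 2 * (1 / x\<^sup>2)"
      using mult_left_mono[OF Digamma_plus1_bounds(2)[OF pos(1)], of "x / 2"] x by (simp add: ln_realpow algebra_simps)
    moreover have "x / 2 * (1 / x\<^sup>2) \<le> 1 / x"
      using x by (simp add: power2_eq_square field_simps)
    ultimately have "\<bar>x * ln x - x / 2 * Digamma (x\<^sup>2 + 1)\<bar> \<le> 1 / x"
      by linarith
    then show ?thesis
      unfolding \<open>R1 0 = _\<close> norm_of_real .
  qed
  have R1_bound: "norm (R1 v) \<le> 4 / x" if v: "v \<in> cball 0 1" for v
  proof -
    have "norm (R1 v - R1 0) \<le> 3 / x * norm (v - 0)"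
      using v by (intro field_differentiable_bound[OF convex_cball dR1 R2_bound]) auto
    also have "\<dots> \<le> 3 / x * 1"
      using v x by (intro mult_left_mono) auto
    finally have "norm (R1 v - R1 0) \<le> 3 / x" by simp
    then have "norm (R1 v) \<le> 3 / x + 1 / x"
      using R1_0 norm_triangle_sub[of "R1 v" "R1 0"] by linarith
    then show ?thesis by simp
  qed
  have "norm (R u - R 0) \<le> 4 / x * norm (u - 0)"
    using u by (intro field_differentiable_bound[OF convex_cball dR R1_bound]) auto
  also have "\<dots> \<le> 4 / x * 1"
    using u x by (intro mult_left_mono) auto
  finally have R: "norm (R u) \<le> 4 / x"
    by (simp add: R_def z_def)
  have "poisson_ratio x u = exp (R u + - u\<^sup>2 / 4)"
    by (simp add: poisson_ratio_def R_def z_def)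
  then have "poisson_ratio x u - exp (- u\<^sup>2 / 4) = (exp (R u) - 1) * exp (- u\<^sup>2 / 4)"
    by (simp only: exp_add) (simp add: algebra_simps)
  then have "norm (poisson_ratio x u - exp (- u\<^sup>2 / 4)) = norm (exp (R u) - exp 0) * norm (exp (- u\<^sup>2 / 4))"
    by (simp add: norm_mult)
  \<comment> \<open>As \<open>x >= 2\<close>, the bound \<open>4 / x\<close> places
    \<open>R u\<close> in the disc of radius 2, where \<open>exp\<close> has Lipschitz constant
    \<open>exp 2\<close>.\<close>
  moreover have "norm (exp (R u) - exp 0) \<le> exp 2 * norm (R u - 0)"
  proof (rule field_differentiable_bound[where S = "cball 0 2" and f = exp and f' = exp])
    show "(exp has_field_derivative exp v) (at v within cball 0 2)" for v :: complex
      by (rule DERIV_exp[THEN has_field_derivative_at_within])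
    show "norm (exp v) \<le> exp 2" if "v \<in> cball 0 2" for v :: complex
      using that norm_exp[of v] by (meson exp_le_cancel_iff mem_cball_0 order_trans)
    have "4 / x \<le> 2" using x by (simp add: field_simps)
    then show "R u \<in> cball 0 2" using R by simp
  qed auto
  moreover have "norm (exp (- u\<^sup>2 / 4)) \<le> exp 1"
  proof -
    have "norm (- u\<^sup>2 / 4) \<le> 1"
      using power_le_one[OF norm_ge_zero u, of 2] by (simp add: norm_divide norm_power)
    then show ?thesis
      using norm_exp[of "- u\<^sup>2 / 4"] by (meson exp_le_cancel_iff order_trans)
  qed
  moreover have "exp 2 * norm (R u - 0) \<le> exp 2 * (4 / x)"
    using mult_left_mono[OF R, of "exp 2"] by simp
  ultimately have "norm (poisson_ratio x u - exp (- u\<^sup>2 / 4)) \<le> exp 2 * (4 / x) * exp 1"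
    by (smt (verit) mult_mono norm_ge_zero exp_gt_zero)
  also have "\<dots> = 4 * exp 3 / x"
    by (simp add: exp_add[symmetric] field_simps)
  finally show ?thesis .
qed

section \<open>Differences of the coefficients along a window\<close>

lemma gauss_deriv_Reals: "u \<in> \<real> \<Longrightarrow> gauss_deriv m u \<in> \<real>"
proof (induction m u rule: gauss_deriv.induct)
  case (1 u)
  then show ?case by (auto elim!: Reals_cases simp flip: exp_of_real of_real_power of_real_minus)
next
  case (2 u)
  then show ?case by (auto elim!: Reals_cases simp flip: exp_of_real of_real_power of_real_minus)
next
  case (3 m u)
  then show ?case by (auto intro!: Reals_diff Reals_mult Reals_divide simp del: of_nat_Suc)
qed

text \<open>The linear form of one point in the scaled variable \<open>u = (v - x^2) / x\<close>,
  relative to the weight at the mean. The variable is complex so that Cauchy's inequality can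
  transfer the Gaussian approximation to derivatives.\<close>

definition window_fun :: "real \<Rightarrow> real \<Rightarrow> real \<Rightarrow> complex \<Rightarrow> complex" where
  "window_fun x p q u = (of_real p + of_real q * u) * poisson_ratio x u"

lemma window_fun_holomorphic: "x > 0 \<Longrightarrow> window_fun x p q holomorphic_on {u. - x < Re u}"
  unfolding window_fun_def
  by (intro holomorphic_on_mult holomorphic_on_add holomorphic_on_const holomorphic_on_ident poisson_ratio_holomorphic)

lemma open_Re_gt: "open {u. a < Re u}"
  by (simp add: open_halfspace_Re_gt)

text \<open>Cauchy's inequality on the circle of radius 1/2 about \<open>u\<close>, which stays in
  the unit disc where the ratio is close to the Gaussian; the radius produces
  \<open>2 ^ k\<close>.\<close>

lemma norm_higher_deriv_window_fun_diff_le: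
  assumes x: "x \<ge> 2" and u: "norm u \<le> 1 / 2"
  shows "norm ((deriv ^^ k) (window_fun x p q) u - (of_real p * gauss_deriv k u - 2 * of_real q * gauss_deriv (Suc k) u))
    \<le> fact k * (8 * exp 3 * max \<bar>p\<bar> \<bar>q\<bar> / x) * 2 ^ k"
proof -
  define G where "G = (\<lambda>u. (complex_of_real p + of_real q * u) * exp (- u\<^sup>2 / 4))"
  let ?S = "{u. - x < Re u}"
  have G_hol: "G holomorphic_on A" for A
    unfolding G_def by (intro holomorphic_intros) auto
  have W_hol: "window_fun x p q holomorphic_on ?S"
    using x by (intro window_fun_holomorphic) simp
  have sub: "cball u (1 / 2) \<subseteq> cball 0 1"
    using u by (intro cball_subset_cball_iff[THEN iffD2]) (simp add: dist_norm)
  have sub2: "cball 0 1 \<subseteq> ?S"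
    using x by (auto dest!: order_trans[OF abs_Re_le_cmod])
  have "u \<in> cball 0 1"
    using u by simp
  then have "u \<in> ?S"
    using sub2 by blast
  have "(deriv ^^ k) (window_fun x p q) u - (of_real p * gauss_deriv k u - 2 * of_real q * gauss_deriv (Suc k) u)
      = (deriv ^^ k) (window_fun x p q) u - (deriv ^^ k) G u"
    unfolding G_def higher_deriv_gauss_comb ..
  also have "\<dots> = (deriv ^^ k) (\<lambda>u. window_fun x p q u - G u) u"
    by (rule higher_deriv_diff[OF W_hol G_hol open_Re_gt \<open>u \<in> ?S\<close>, symmetric])
  also have "norm \<dots> \<le> fact k * (8 * exp 3 * max \<bar>p\<bar> \<bar>q\<bar> / x) / (1 / 2) ^ k"
  proof (rule Cauchy_inequality)
    have "(\<lambda>u. window_fun x p q u - G u) holomorphic_on cball u (1 / 2)"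
      by (intro holomorphic_on_diff G_hol holomorphic_on_subset[OF W_hol] order_trans[OF sub sub2])
    then show "(\<lambda>u. window_fun x p q u - G u) holomorphic_on ball u (1 / 2)"
      "continuous_on (cball u (1 / 2)) (\<lambda>u. window_fun x p q u - G u)"
      using holomorphic_on_subset[OF _ ball_subset_cball] holomorphic_on_imp_continuous_on by blast+
    fix w assume "norm (u - w) = 1 / 2"
    then have "w \<in> cball u (1 / 2)"
      by (simp add: dist_norm)
    then have w: "norm w \<le> 1"
      using sub by auto
    have "window_fun x p q w - G w = (of_real p + of_real q * w) * (poisson_ratio x w - exp (- w\<^sup>2 / 4))"
      by (simp add: window_fun_def G_def right_diff_distrib)
    also have "norm \<dots> = norm (of_real p + of_real q * w) * norm (poisson_ratio x w - exp (- w\<^sup>2 / 4))"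
      by (rule norm_mult)
    also have "\<dots> \<le> (2 * max \<bar>p\<bar> \<bar>q\<bar>) * (4 * exp 3 / x)"
    proof (intro mult_mono norm_poisson_ratio_minus_gauss_le x w)
      have "\<bar>q\<bar> * norm w \<le> \<bar>q\<bar> * 1"
        using w by (intro mult_left_mono) auto
      then show "norm (of_real p + of_real q * w) \<le> 2 * max \<bar>p\<bar> \<bar>q\<bar>"
        using norm_triangle_ineq[of "of_real p" "of_real q * w"] by (simp add: norm_mult)
    qed auto
    finally show "norm (window_fun x p q w - G w) \<le> 8 * exp 3 * max \<bar>p\<bar> \<bar>q\<bar> / x"
      by (simp add: mult_ac)
  qed simp
  finally show ?thesis by (simp add: power_divide)
qed

text \<open>At \<open>u = 0\<close> only one of the two terms of the \<open>k\<close>-th derivative survives: that of \<open>p\<close> for even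
  \<open>k\<close> and that of \<open>q\<close> for odd \<open>k\<close>.\<close>

lemma higher_deriv_window_fun_approx:
  fixes k :: nat
  obtains \<alpha> r X where "\<alpha> > 0" "0 < r" "r \<le> 1 / 2" "X \<ge> (2::real)"
    "\<And>x p q. x \<ge> X \<Longrightarrow> (if even k then \<bar>q\<bar> \<le> \<bar>p\<bar> else \<bar>p\<bar> \<le> \<bar>q\<bar>) \<Longrightarrow>
      \<exists>A. \<bar>A\<bar> = \<alpha> * max \<bar>p\<bar> \<bar>q\<bar> \<and>
        (\<forall>u. \<bar>u\<bar> \<le> r \<longrightarrow> \<bar>Re ((deriv ^^ k) (window_fun x p q) (of_real u)) - A\<bar> \<le> \<bar>A\<bar> / 2)"
proof -
  let ?g = "gauss_deriv k" and ?g' = "gauss_deriv (Suc k)"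
  define \<alpha> where "\<alpha> = (if even k then norm (?g 0) else 2 * norm (?g' 0))"
  have "\<alpha> > 0"
    using gauss_deriv_0_eq_0_iff[of k] gauss_deriv_0_eq_0_iff[of "Suc k"] by (simp add: \<alpha>_def del: gauss_deriv.simps)
  have cont: "isCont (gauss_deriv m) 0" for m
    using has_field_derivative_gauss_deriv by (rule DERIV_isCont)
  have ex: "\<exists>r>0. \<forall>u. norm u < r \<longrightarrow> norm (gauss_deriv m u - gauss_deriv m 0) < \<alpha> / 16" for m
    using cont[of m, unfolded continuous_at_eps_delta, rule_format, of "\<alpha> / 16"] \<open>\<alpha> > 0\<close> by (simp add: dist_norm)
  obtain r1 where r1: "r1 > 0" "\<And>u. norm u < r1 \<Longrightarrow> norm (?g u - ?g 0) < \<alpha> / 16"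
    using ex[of k] by blast
  obtain r2 where r2: "r2 > 0" "\<And>u. norm u < r2 \<Longrightarrow> norm (?g' u - ?g' 0) < \<alpha> / 16"
    using ex[of "Suc k"] by blast
  \<comment> \<open>Within \<open>r\<close> both Gaussian derivatives stay within
    \<open>\<alpha> / 16\<close> of their values at 0, and beyond \<open>X\<close> the Cauchy error
    has factor at most \<open>\<alpha> / 4\<close>. Each of the two errors is thus at most a quarter
    of \<open>\<bar>A\<bar>\<close>.\<close>
  define r where "r = min (1 / 2) (min (r1 / 2) (r2 / 2))"
  define X where "X = max 2 (fact k * (8 * exp 3) * 2 ^ k * 4 / \<alpha>)"
  show ?thesis
  proof (rule that[of \<alpha> r X])
    show "0 < r" "r \<le> 1 / 2" "X \<ge> 2"
      using r1 r2 by (auto simp: r_def X_def)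
    fix x p q :: real
    assume "x \<ge> X" and pq: "if even k then \<bar>q\<bar> \<le> \<bar>p\<bar> else \<bar>p\<bar> \<le> \<bar>q\<bar>"
    let ?P = "max \<bar>p\<bar> \<bar>q\<bar>"
    define A where "A = Re (of_real p * ?g 0 - 2 * of_real q * ?g' 0)"
    have real: "?g 0 = of_real (Re (?g 0))" "?g' 0 = of_real (Re (?g' 0))"
      using gauss_deriv_Reals[of 0] by (simp_all add: of_real_Re del: gauss_deriv.simps)
    have A: "\<bar>A\<bar> = \<alpha> * ?P"
    proof (cases "even k")
      case True
      then have "?g' 0 = 0" using gauss_deriv_0_eq_0_iff[of "Suc k"] by simp
      then have "\<bar>A\<bar> = norm (of_real p * ?g 0)"
        unfolding A_def by (subst (1 2) real(1)) (simp del: gauss_deriv.simps add: norm_mult abs_mult)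
      then show ?thesis using True pq by (simp add: \<alpha>_def norm_mult del: gauss_deriv.simps)
    next
      case False
      then have "?g 0 = 0" using gauss_deriv_0_eq_0_iff[of k] by simp
      then have "\<bar>A\<bar> = norm (2 * of_real q * ?g' 0)"
        unfolding A_def by (subst (1 2) real(2)) (simp del: gauss_deriv.simps add: norm_mult abs_mult)
      then show ?thesis using False pq by (simp add: \<alpha>_def norm_mult del: gauss_deriv.simps)
    qed
    moreover have "\<bar>Re ((deriv ^^ k) (window_fun x p q) (of_real u)) - A\<bar> \<le> \<bar>A\<bar> / 2" if u: "\<bar>u\<bar> \<le> r" for u
    proof -
      let ?v = "complex_of_real u"
      have u': "norm ?v \<le> 1 / 2" "norm ?v < r1" "norm ?v < r2"
        using u r1 r2 by (auto simp: r_def)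
      have "x > 0" "x \<ge> 2" using \<open>x \<ge> X\<close> by (auto simp: X_def)
      have "fact k * (8 * exp 3) * 2 ^ k * 4 / \<alpha> \<le> x"
        using \<open>x \<ge> X\<close> by (simp add: X_def)
      then have small: "fact k * (8 * exp 3) * 2 ^ k / x \<le> \<alpha> / 4"
        using \<open>\<alpha> > 0\<close> \<open>x > 0\<close> by (simp add: field_simps)
      have "norm ((deriv ^^ k) (window_fun x p q) ?v - (of_real p * ?g ?v - 2 * of_real q * ?g' ?v))
          \<le> fact k * (8 * exp 3 * ?P / x) * 2 ^ k"
        by (rule norm_higher_deriv_window_fun_diff_le[OF \<open>x \<ge> 2\<close> u'(1)])
      also have "\<dots> = (fact k * (8 * exp 3) * 2 ^ k / x) * ?P"
        by simp
      also have "\<dots> \<le> \<alpha> / 4 * ?P"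
        using small by (intro mult_right_mono) auto
      finally have 1: "norm ((deriv ^^ k) (window_fun x p q) ?v - (of_real p * ?g ?v - 2 * of_real q * ?g' ?v)) \<le> \<alpha> / 4 * ?P" .
      have "norm ((of_real p * ?g ?v - 2 * of_real q * ?g' ?v) - (of_real p * ?g 0 - 2 * of_real q * ?g' 0))
          = norm (of_real p * (?g ?v - ?g 0) - 2 * of_real q * (?g' ?v - ?g' 0))"
        by (rule arg_cong[where f = norm]) (simp add: algebra_simps del: gauss_deriv.simps)
      also have "\<dots> \<le> \<bar>p\<bar> * norm (?g ?v - ?g 0) + 2 * \<bar>q\<bar> * norm (?g' ?v - ?g' 0)"
        using norm_triangle_ineq4[of "of_real p * (?g ?v - ?g 0)" "2 * of_real q * (?g' ?v - ?g' 0)"]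
        by (simp add: norm_mult del: gauss_deriv.simps)
      also have "\<dots> \<le> ?P * (\<alpha> / 16) + 2 * ?P * (\<alpha> / 16)"
        using r1(2)[OF u'(2)] r2(2)[OF u'(3)] by (intro add_mono mult_mono) auto
      also have "\<dots> \<le> \<alpha> / 4 * ?P"
      proof -
        have "0 \<le> \<alpha> * ?P"
          using \<open>\<alpha> > 0\<close> by (intro mult_nonneg_nonneg) auto
        then show ?thesis by simp
      qed
      finally have 2: "norm ((of_real p * ?g ?v - 2 * of_real q * ?g' ?v) - (of_real p * ?g 0 - 2 * of_real q * ?g' 0)) \<le> \<alpha> / 4 * ?P" .
      have "\<bar>Re ((deriv ^^ k) (window_fun x p q) ?v) - A\<bar>
          \<le> norm ((deriv ^^ k) (window_fun x p q) ?v - (of_real p * ?g 0 - 2 * of_real q * ?g' 0))"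
        unfolding A_def minus_complex.sel(1)[symmetric] by (rule abs_Re_le_cmod)
      also have "\<dots> \<le> \<alpha> / 4 * ?P + \<alpha> / 4 * ?P"
        by (rule norm_diff_triangle_le[OF 1 2])
      also have "\<dots> = \<bar>A\<bar> / 2"
        using A by simp
      finally show ?thesis .
    qed
    ultimately show "\<exists>A. \<bar>A\<bar> = \<alpha> * ?P \<and>
        (\<forall>u. \<bar>u\<bar> \<le> r \<longrightarrow> \<bar>Re ((deriv ^^ k) (window_fun x p q) (of_real u)) - A\<bar> \<le> \<bar>A\<bar> / 2)"
      by blast
  qed (fact \<open>\<alpha> > 0\<close>)
qed

lemma DERIV_Re_of_real:
  assumes "(f has_field_derivative f') (at (complex_of_real v))"
  shows "((\<lambda>v. Re (f (of_real v))) has_real_derivative Re f') (at v)"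
  using assms by (auto intro!: derivative_eq_intros has_vector_derivative_real_field)

lemma poisson_root_pos: "0 < poisson_root x z"
  by (simp add: poisson_root_def)

text \<open>At an integer \<open>i\<close> this is \<open>(p b_i(x) + q c_i(x)) / sqrt N\<close>,
  because \<open>c_i\<close> is \<open>b_i\<close> times \<open>(i - x^2) / x\<close>.\<close>

definition window_term :: "real \<Rightarrow> real \<Rightarrow> real \<Rightarrow> real \<Rightarrow> real" where
  "window_term x p q v = poisson_root x v * (p + q * ((v - x\<^sup>2) / x))"

lemma window_term_eq:
  assumes "x > 0" "x\<^sup>2 \<le> v"
  shows "window_term x p q v = poisson_root x (x\<^sup>2) * Re (window_fun x p q (of_real ((v - x\<^sup>2) / x)))"
proof -
  let ?u = "(v - x\<^sup>2) / x"
  have eq: "x\<^sup>2 + x * ?u = v" using assms by simp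
  have "0 < x\<^sup>2 + 1 + x * ?u"
    using assms zero_le_power2[of x] unfolding add.commute[of "x\<^sup>2" 1] add.assoc eq by linarith
  from poisson_root_eq_ratio[OF assms(1) this]
  have "complex_of_real (window_term x p q v) = of_real (poisson_root x (x\<^sup>2)) * window_fun x p q (of_real ?u)"
    unfolding eq by (simp add: window_term_def window_fun_def)
  then have "Re (complex_of_real (window_term x p q v)) = Re (of_real (poisson_root x (x\<^sup>2)) * window_fun x p q (of_real ?u))"
    by (rule arg_cong)
  then show ?thesis by simp
qed

text \<open>Under \<open>v = x^2 + x * u\<close> every derivative in \<open>v\<close> brings a
  factor \<open>1 / x\<close>, so a step \<open>h\<close> in the index acts as a step
  \<open>h / x\<close> on the window function.\<close>

lemma fdiff_window_term:
  fixes h v :: real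
  assumes x: "x > 0" and "h \<ge> 0" "x\<^sup>2 \<le> v" "v + real k * h \<le> x\<^sup>2 + r * x"
    and A: "\<And>u. \<bar>u\<bar> \<le> r \<Longrightarrow> \<bar>Re ((deriv ^^ k) (window_fun x p q) (of_real u)) - A\<bar> \<le> B"
  shows "\<bar>fdiff h k (window_term x p q) v - poisson_root x (x\<^sup>2) * (h / x) ^ k * A\<bar> \<le> poisson_root x (x\<^sup>2) * (h / x) ^ k * B"
proof -
  define F where "F = (\<lambda>m v. (1 / x) ^ m * Re ((deriv ^^ m) (window_fun x p q) (of_real ((v - x\<^sup>2) / x))))"
  have "\<bar>fdiff h k (F 0) v - h ^ k * ((1 / x) ^ k * A)\<bar> \<le> h ^ k * ((1 / x) ^ k * B)"
  proof (rule fdiff_approx[OF \<open>h \<ge> 0\<close>])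
    fix m w assume w: "v \<le> w" "w \<le> v + real k * h"
    let ?u = "(w - x\<^sup>2) / x"
    have "?u \<ge> 0" using w assms(3) x by simp
    then have dom: "complex_of_real ?u \<in> {u. - x < Re u}" using x by simp
    have "((deriv ^^ m) (window_fun x p q) has_field_derivative (deriv ^^ Suc m) (window_fun x p q) (of_real ?u)) (at (of_real ?u))"
      using holomorphic_derivI[OF holomorphic_higher_deriv[OF window_fun_holomorphic[OF x] open_Re_gt] open_Re_gt dom] by simp
    then have "((\<lambda>v. Re ((deriv ^^ m) (window_fun x p q) (of_real v))) has_real_derivative
        Re ((deriv ^^ Suc m) (window_fun x p q) (of_real ?u))) (at ?u)"
      by (rule DERIV_Re_of_real)
    moreover have "((\<lambda>w. (w - x\<^sup>2) / x) has_real_derivative 1 / x) (at w)"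
      using x by (auto intro!: derivative_eq_intros)
    ultimately have "((\<lambda>w. Re ((deriv ^^ m) (window_fun x p q) (of_real ((w - x\<^sup>2) / x)))) has_real_derivative
        Re ((deriv ^^ Suc m) (window_fun x p q) (of_real ?u)) * (1 / x)) (at w)"
      by (rule DERIV_chain2)
    from DERIV_cmult[OF this, of "(1 / x) ^ m"] show "(F m has_real_derivative F (Suc m) w) (at w)"
      unfolding F_def by (simp only: power_Suc mult_ac)
  next
    fix w assume w: "v \<le> w" "w \<le> v + real k * h"
    have "\<bar>(w - x\<^sup>2) / x\<bar> \<le> r"
      using w assms(3,4) x by (simp add: pos_divide_le_eq)
    from mult_left_mono[OF A[OF this], of "(1 / x) ^ k"] show "\<bar>F k w - (1 / x) ^ k * A\<bar> \<le> (1 / x) ^ k * B"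
      using x by (simp add: F_def abs_mult flip: right_diff_distrib)
  qed
  from mult_left_mono[OF this, of "poisson_root x (x\<^sup>2)"]
  have that: "poisson_root x (x\<^sup>2) * \<bar>fdiff h k (F 0) v - h ^ k * ((1 / x) ^ k * A)\<bar>
      \<le> poisson_root x (x\<^sup>2) * (h ^ k * ((1 / x) ^ k * B))"
    by (simp add: less_imp_le[OF poisson_root_pos])
  have "\<bar>poisson_root x (x\<^sup>2) * fdiff h k (F 0) v - poisson_root x (x\<^sup>2) * (h / x) ^ k * A\<bar> \<le> poisson_root x (x\<^sup>2) * (h / x) ^ k * B"
  proof -
    let ?W = "poisson_root x (x\<^sup>2)"
    have "?W * fdiff h k (F 0) v - ?W * (h / x) ^ k * A = ?W * (fdiff h k (F 0) v - h ^ k * ((1 / x) ^ k * A))"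
      "?W * (h / x) ^ k * B = ?W * (h ^ k * ((1 / x) ^ k * B))"
      by (simp_all add: power_divide right_diff_distrib)
    then show ?thesis
      using that by (simp only: abs_mult abs_of_pos[OF poisson_root_pos])
  qed
  moreover have "fdiff h k (window_term x p q) v = fdiff h k (\<lambda>v. poisson_root x (x\<^sup>2) * F 0 v) v"
  proof (rule fdiff_cong)
    fix j
    have "0 \<le> real j * h" using \<open>h \<ge> 0\<close> by simp
    then show "window_term x p q (v + real j * h) = poisson_root x (x\<^sup>2) * F 0 (v + real j * h)"
      using window_term_eq[OF x, of "v + real j * h" p q] assms(3) by (simp add: F_def)
  qed
  ultimately show ?thesis by (simp add: fdiff_cmult)
qed

section \<open>Lower bound for the sum over one window\<close>

lemma card_nat_interval_ge:
  assumes "0 \<le> a"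
  shows "b - a - 1 \<le> real (card {i::nat. a \<le> real i \<and> real i \<le> b})"
proof (cases "a \<le> b")
  case True
  have "{i::nat. a \<le> real i \<and> real i \<le> b} = {nat \<lceil>a\<rceil>..nat \<lfloor>b\<rfloor>}"
    using assms True by (auto simp: le_nat_floor nat_le_iff ceiling_le_iff le_nat_iff le_floor_iff)
  then show ?thesis
    using assms True by (simp add: of_nat_diff) linarith
qed auto

lemma finite_nat_interval: "finite {i::nat. a \<le> real i \<and> real i \<le> b}"
proof (rule finite_subset)
  show "{i::nat. a \<le> real i \<and> real i \<le> b} \<subseteq> {..nat \<lceil>b\<rceil>}"
    by (auto simp: le_nat_iff) linarith
qed simp

text \<open>For each fixed \<open>j\<close> the shift is injective and stays inside the longer
  interval; there are \<open>k + 1\<close> shifts.\<close>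

lemma sum_shifted_le:
  fixes F :: "real \<Rightarrow> real"
  assumes nonneg: "\<And>v. 0 \<le> F v" and "h \<ge> 0" and "b + real (k * h) \<le> b'"
  shows "(\<Sum>i | a \<le> real i \<and> real i \<le> b. \<Sum>j\<le>k. F (real i + real j * real h))
    \<le> real (Suc k) * (\<Sum>i | a \<le> real i \<and> real i \<le> b'. F (real i))"
proof -
  let ?I = "{i::nat. a \<le> real i \<and> real i \<le> b}" and ?J = "{i::nat. a \<le> real i \<and> real i \<le> b'}"
  have "(\<Sum>i\<in>?I. \<Sum>j\<le>k. F (real i + real j * real h)) = (\<Sum>j\<le>k. \<Sum>i\<in>?I. F (real (i + j * h)))"
    by (subst sum.swap) simp
  also have "\<dots> \<le> (\<Sum>j\<le>k. \<Sum>i\<in>?J. F (real i))"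
  proof (rule sum_mono)
    fix j assume "j \<in> {..k}"
    then have "j * h \<le> k * h" by simp
    then have "real (j * h) \<le> real (k * h)" by (simp only: of_nat_le_iff)
    then have "(\<lambda>i. i + j * h) ` ?I \<subseteq> ?J"
      using assms(3) by (auto intro!: add_increasing2)
    then have "(\<Sum>i\<in>(\<lambda>i. i + j * h) ` ?I. F (real i)) \<le> (\<Sum>i\<in>?J. F (real i))"
      using nonneg by (intro sum_mono2 finite_nat_interval) auto
    then show "(\<Sum>i\<in>?I. F (real (i + j * h))) \<le> (\<Sum>i\<in>?J. F (real i))"
      by (subst (asm) sum.reindex) (auto simp: inj_on_def)
  qed
  also have "\<dots> = real (Suc k) * (\<Sum>i\<in>?J. F (real i))"
    by simp
  finally show ?thesis .
qed

text \<open>The growth conditions for the choice of the step: the first, where \<open>C < k\<close>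
  enters, and the third leave room for an integer step, and the second makes the error smaller than
  the main term.\<close>

lemma eventually_powr_bounds:
  fixes C \<alpha> s0 r :: real
  assumes "C < real k" "\<alpha> > 0" "s0 > 0" "r > 0"
  shows "\<forall>\<^sub>F x in at_top. 2 * \<alpha> * x powr C \<le> s0 * x ^ k \<and> 2 ^ k / x \<le> \<alpha> / 4 * (exp (- 1 / 2) / sqrt x)
     \<and> 1 \<le> x * r \<and> 2 \<le> x"
proof (intro eventually_conj)
  have "\<forall>\<^sub>F x in at_top. 2 * \<alpha> / s0 \<le> x powr (real k - C)"
  proof -
    define d where "d = real k - C"
    have "d > 0" using assms(1) by (simp add: d_def)
    then have "filterlim (\<lambda>x::real. x powr d) at_top at_top" by real_asymp
    then show ?thesis unfolding filterlim_at_top d_def by blast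
  qed
  then show "\<forall>\<^sub>F x in at_top. 2 * \<alpha> * x powr C \<le> s0 * x ^ k"
    using eventually_gt_at_top[of 0]
  proof eventually_elim
    case (elim x)
    then have "2 * \<alpha> \<le> s0 * x powr (real k - C)" using assms by (simp add: field_simps)
    then have "2 * \<alpha> * x powr C \<le> s0 * x powr (real k - C) * x powr C"
      by (intro mult_right_mono) auto
    also have "\<dots> = s0 * x ^ k"
      using elim by (simp add: powr_realpow flip: powr_add)
    finally show ?case .
  qed
  show "\<forall>\<^sub>F x in at_top. 2 ^ k / x \<le> \<alpha> / 4 * (exp (- 1 / 2) / sqrt x)"
    using assms by real_asymp
  show "\<forall>\<^sub>F x in at_top. 1 \<le> x * r"
    using assms by real_asymp
  show "\<forall>\<^sub>F x::real in at_top. 2 \<le> x"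
    by (rule eventually_ge_at_top)
qed


text \<open>A \<open>k\<close>-th difference of step \<open>h\<close> has size about
  \<open>Y = W0 * P * \<alpha> * (h / x) ^ k\<close>, where \<open>P\<close> is the larger
  coefficient and \<open>W0\<close> the weight at the mean. The step is taken as large as possible
  with \<open>Y\<close> at most \<open>s0 / 2\<close>, so that \<open>Y\<close> is comparable to
  \<open>min (W0 * P) 1\<close> and \<open>D\<close> is quadratic at the difference. Summing over
  order \<open>x\<close> starting points gives order \<open>x * (min (W0 * P) 1)^2\<close>. The
  function \<open>e\<close> leaves room for the other point.\<close>

lemma window_sum_lower:
  fixes D :: "real \<Rightarrow> real" and k :: nat and C \<kappa> s0 :: real
  assumes nonneg: "\<And>s. 0 \<le> D s" and sub: "\<And>s t. D (s - t) \<le> 2 * D s + 2 * D t"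
    and quad: "\<And>s. \<bar>s\<bar> \<le> s0 \<Longrightarrow> \<kappa> * s\<^sup>2 \<le> D s" and "s0 > 0" "\<kappa> > 0"
    and k: "k \<ge> 1" "C < real k"
  obtains c X where "c > 0"
    "\<And>x p q e. x \<ge> X \<Longrightarrow> (if even k then \<bar>q\<bar> \<le> \<bar>p\<bar> else \<bar>p\<bar> \<le> \<bar>q\<bar>) \<Longrightarrow>
      0 < max \<bar>p\<bar> \<bar>q\<bar> \<Longrightarrow> max \<bar>p\<bar> \<bar>q\<bar> \<le> x powr C \<Longrightarrow>
      (\<And>v. x\<^sup>2 \<le> v \<Longrightarrow> v \<le> x\<^sup>2 + x \<Longrightarrow> \<bar>e v\<bar> \<le> max \<bar>p\<bar> \<bar>q\<bar> / x ^ Suc k) \<Longrightarrow>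
      c * min ((max \<bar>p\<bar> \<bar>q\<bar>)\<^sup>2) x \<le> (\<Sum>i | x\<^sup>2 \<le> real i \<and> real i \<le> x\<^sup>2 + x. D (window_term x p q (real i) + e (real i)))"
proof -
  obtain \<alpha> r X1 where \<alpha>: "\<alpha> > 0" and r: "0 < r" "r \<le> 1 / 2" and "X1 \<ge> (2::real)"
    and deriv_approx: "\<And>x p q. x \<ge> X1 \<Longrightarrow> (if even k then \<bar>q\<bar> \<le> \<bar>p\<bar> else \<bar>p\<bar> \<le> \<bar>q\<bar>) \<Longrightarrow>
      \<exists>A. \<bar>A\<bar> = \<alpha> * max \<bar>p\<bar> \<bar>q\<bar> \<and>
        (\<forall>u. \<bar>u\<bar> \<le> r \<longrightarrow> \<bar>Re ((deriv ^^ k) (window_fun x p q) (of_real u)) - A\<bar> \<le> \<bar>A\<bar> / 2)"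
    using higher_deriv_window_fun_approx[of k] by blast
  \<comment> \<open>With \<open>h <= \<rho> * x\<close> a progression of \<open>k\<close> steps has
    length at most \<open>r * x / 2\<close>; started in the first half of the interval of length
    \<open>r * x\<close> it remains inside.\<close>
  define \<rho> where "\<rho> = r / (2 * real k)"
  have \<rho>: "0 < \<rho>" "\<rho> \<le> r / 2"
    using r k by (auto simp: \<rho>_def field_simps)
  have "\<forall>\<^sub>F x in at_top. 2 * \<alpha> * x powr C \<le> s0 * x ^ k \<and> 2 ^ k / x \<le> \<alpha> / 4 * (exp (- 1 / 2) / sqrt x)
     \<and> 1 \<le> x * (\<rho> / 2) \<and> 2 \<le> x"
    using \<rho> by (intro eventually_powr_bounds k \<alpha> \<open>s0 > 0\<close>) simp
  then obtain X2 where X2: "\<And>x. x \<ge> X2 \<Longrightarrow> 2 * \<alpha> * x powr C \<le> s0 * x ^ k"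
    "\<And>x. x \<ge> X2 \<Longrightarrow> 2 ^ k / x \<le> \<alpha> / 4 * (exp (- 1 / 2) / sqrt x)"
    "\<And>x. x \<ge> X2 \<Longrightarrow> 1 \<le> x * (\<rho> / 2)" "\<And>x. x \<ge> X2 \<Longrightarrow> 2 \<le> x"
    unfolding eventually_at_top_linorder by blast
  define c1 where "c1 = min (\<rho> ^ k * \<alpha>) (s0 / 2) / 2 ^ k"
  have "c1 > 0" using \<rho> \<alpha> \<open>s0 > 0\<close> by (simp add: c1_def)
  define c where "c = r / 4 * (\<kappa> * (c1 / 4)\<^sup>2) / (4 ^ k * real (Suc k)) * exp (- 1)"
  have "c > 0" using r \<open>\<kappa> > 0\<close> \<open>c1 > 0\<close> by (simp add: c_def)
  show ?thesis
  proof (rule that[of c "max X1 X2"])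
    fix x p q :: real and e :: "real \<Rightarrow> real"
    let ?P = "max \<bar>p\<bar> \<bar>q\<bar>"
    assume "x \<ge> max X1 X2" and pq: "if even k then \<bar>q\<bar> \<le> \<bar>p\<bar> else \<bar>p\<bar> \<le> \<bar>q\<bar>"
      and P: "0 < ?P" "?P \<le> x powr C"
      and e: "\<And>v. x\<^sup>2 \<le> v \<Longrightarrow> v \<le> x\<^sup>2 + x \<Longrightarrow> \<bar>e v\<bar> \<le> ?P / x ^ Suc k"
    then have "x \<ge> X1" "x \<ge> X2" by auto
    note x = X2[OF \<open>x \<ge> X2\<close>]
    have "x > 0" "x \<ge> 1" using x(4) by auto
    define W0 where "W0 = poisson_root x (x\<^sup>2)"
    have W0: "0 < W0" "W0 \<le> 1" "exp (- 1 / 2) / sqrt x \<le> W0"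
      using poisson_root_mean_bounds[OF \<open>x \<ge> 1\<close>] by (auto simp: W0_def poisson_root_pos)
    define T where "T = W0 * ?P"
    have "T > 0" "T \<le> ?P" using W0 P by (auto simp: T_def mult_left_le_one_le)
    \<comment> \<open>The largest ratio \<open>h / x\<close> that respects both the cap
      \<open>\<rho>\<close> and the condition \<open>T * \<alpha> * m ^ k <= s0 / 2\<close>.\<close>
    define m where "m = root k (min (\<rho> ^ k) (s0 / (2 * T * \<alpha>)))"
    have mk: "m ^ k = min (\<rho> ^ k) (s0 / (2 * T * \<alpha>))"
      unfolding m_def using \<rho> \<alpha> \<open>T > 0\<close> \<open>s0 > 0\<close> k by (intro real_root_pow_pos2) auto
    have "m > 0"
      unfolding m_def using \<rho> \<alpha> \<open>T > 0\<close> \<open>s0 > 0\<close> k by (intro real_root_gt_zero) auto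
    have "m \<le> \<rho>"
      using mk \<rho> k by (intro power_le_imp_le_base[of m "k - 1"]) auto
    \<comment> \<open>An integer step must fit. Under the cap this holds for large \<open>x\<close>;
      under the other condition it holds because \<open>T <= x powr C\<close> and
      \<open>C < k\<close>.\<close>
    have "1 \<le> (x * m) ^ k"
    proof -
      have "1 \<le> x * \<rho>" using x(3) \<rho> \<open>x > 0\<close> by simp
      then have "1 \<le> (x * \<rho>) ^ k" by (rule one_le_power)
      moreover have "1 \<le> x ^ k * (s0 / (2 * T * \<alpha>))"
      proof -
        have "2 * \<alpha> * T \<le> 2 * \<alpha> * x powr C"
          using \<alpha> P(2) \<open>T \<le> ?P\<close> by (intro mult_left_mono) auto
        also note x(1)
        finally show ?thesis using \<open>T > 0\<close> \<alpha> by (simp add: field_simps)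
      qed
      ultimately show ?thesis
        unfolding power_mult_distrib mk by (simp add: min_def)
    qed
    then have "1 \<le> x * m"
      using power_strict_mono[of "x * m" 1 k] \<open>x > 0\<close> \<open>m > 0\<close> k by (cases "x * m < 1") auto
    \<comment> \<open>Rounding down loses at most a factor 2, since
      \<open>x * m >= 1\<close>.\<close>
    define h where "h = nat \<lfloor>x * m\<rfloor>"
    have h: "real h \<le> x * m" "x * m / 2 \<le> real h" "1 \<le> real h"
    proof -
      have "1 \<le> \<lfloor>x * m\<rfloor>" using \<open>1 \<le> x * m\<close> by (simp add: le_floor_iff)
      then have "real h = of_int \<lfloor>x * m\<rfloor>" "1 \<le> real_of_int \<lfloor>x * m\<rfloor>"
        by (simp_all add: h_def)
      then show "real h \<le> x * m" "x * m / 2 \<le> real h" "1 \<le> real h"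
        by linarith+
    qed
    have hk: "(h / x) ^ k \<le> m ^ k" "m ^ k / 2 ^ k \<le> (h / x) ^ k" "(1 / x) ^ k \<le> (h / x) ^ k"
    proof -
      show "(h / x) ^ k \<le> m ^ k"
        using h \<open>x > 0\<close> by (intro power_mono) (auto simp: field_simps)
      have "(m / 2) ^ k \<le> (h / x) ^ k"
        using h \<open>x > 0\<close> \<open>m > 0\<close> by (intro power_mono) (auto simp: field_simps)
      then show "m ^ k / 2 ^ k \<le> (h / x) ^ k"
        by (simp add: power_divide)
      show "(1 / x) ^ k \<le> (h / x) ^ k"
        using h \<open>x > 0\<close> by (intro power_mono divide_right_mono) auto
    qed
    define Y where "Y = T * \<alpha> * (h / x) ^ k"
    have Y_upper: "Y \<le> s0 / 2"
    proof -
      have "Y \<le> T * \<alpha> * (s0 / (2 * T * \<alpha>))"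
        unfolding Y_def using hk(1) mk \<open>T > 0\<close> \<alpha> by (intro mult_left_mono) auto
      then show ?thesis using \<open>T > 0\<close> \<alpha> by simp
    qed
    have Y_lower: "c1 * min T 1 \<le> Y"
    proof -
      have "min (\<rho> ^ k * \<alpha>) (s0 / 2) * min T 1 \<le> T * \<alpha> * m ^ k"
      \<comment> \<open>If the cap decides \<open>m\<close>, then \<open>Y\<close> is proportional
        to \<open>T\<close>; otherwise it is comparable to \<open>s0\<close>.\<close>
      proof (cases "\<rho> ^ k \<le> s0 / (2 * T * \<alpha>)")
        case True
        have "min (\<rho> ^ k * \<alpha>) (s0 / 2) * min T 1 \<le> (\<rho> ^ k * \<alpha>) * T"
          using \<open>T > 0\<close> \<rho> \<alpha> \<open>s0 > 0\<close> by (intro mult_mono) auto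
        then show ?thesis using True mk by (simp add: mult_ac)
      next
        case False
        then have "T * \<alpha> * m ^ k = s0 / 2"
          using mk \<open>T > 0\<close> \<alpha> by simp
        moreover have "min (\<rho> ^ k * \<alpha>) (s0 / 2) * min T 1 \<le> (s0 / 2) * 1"
          using \<open>T > 0\<close> \<rho> \<alpha> \<open>s0 > 0\<close> by (intro mult_mono) auto
        ultimately show ?thesis by simp
      qed
      then have "c1 * min T 1 \<le> T * \<alpha> * (m ^ k / 2 ^ k)"
        by (simp add: c1_def field_simps)
      also have "\<dots> \<le> Y"
        unfolding Y_def using hk(2) \<open>T > 0\<close> \<alpha> by (intro mult_left_mono) auto
      finally show ?thesis .
    qed
    have "Y > 0" using Y_lower \<open>c1 > 0\<close> \<open>T > 0\<close> by (smt (verit) mult_pos_pos)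
    obtain A where A: "\<bar>A\<bar> = \<alpha> * ?P"
      and A': "\<And>u. \<bar>u\<bar> \<le> r \<Longrightarrow> \<bar>Re ((deriv ^^ k) (window_fun x p q) (of_real u)) - A\<bar> \<le> \<bar>A\<bar> / 2"
      using deriv_approx[OF \<open>x \<ge> X1\<close> pq] by blast
    have kh: "real (k * h) \<le> r / 2 * x"
    proof -
      have "real k * real h \<le> real k * (x * \<rho>)"
        using h(1) \<open>m \<le> \<rho>\<close> \<open>x > 0\<close> by (intro mult_left_mono) (auto intro: order_trans)
      then show ?thesis using k by (simp add: \<rho>_def field_simps)
    qed
    let ?f = "\<lambda>v. window_term x p q v + e v"
    have each: "\<kappa> * (Y / 4)\<^sup>2 \<le> 4 ^ k * (\<Sum>j\<le>k. D (?f (v + real j * real h)))"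
      if v: "x\<^sup>2 \<le> v" "v \<le> x\<^sup>2 + r / 2 * x" for v
    proof -
      have "\<bar>fdiff (real h) k (window_term x p q) v - W0 * (h / x) ^ k * A\<bar> \<le> W0 * (h / x) ^ k * (\<bar>A\<bar> / 2)"
        unfolding W0_def using v kh \<open>x > 0\<close> by (intro fdiff_window_term[where r = r] A') auto
      then have main: "\<bar>fdiff (real h) k (window_term x p q) v - W0 * (h / x) ^ k * A\<bar> \<le> Y / 2"
        unfolding A Y_def T_def by (simp add: mult_ac)
      have size: "\<bar>W0 * (h / x) ^ k * A\<bar> = Y"
        unfolding abs_mult A Y_def T_def using W0 \<open>x > 0\<close> by simp
      have "\<bar>fdiff (real h) k e v\<bar> \<le> 2 ^ k * (?P / x ^ Suc k)"
      proof (rule abs_fdiff_le)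
        fix j assume "j \<le> k"
        then have "real j * real h \<le> real (k * h)" by (simp add: mult_right_mono)
        moreover have "r * x \<le> 1 * x" using r \<open>x > 0\<close> by (intro mult_right_mono) auto
        ultimately have "v + real j * real h \<le> x\<^sup>2 + x" using v kh by simp
        moreover have "x\<^sup>2 \<le> v + real j * real h" using v by (simp add: add_increasing2)
        ultimately show "\<bar>e (v + real j * real h)\<bar> \<le> ?P / x ^ Suc k" by (intro e)
      qed
      \<comment> \<open>One factor \<open>1 / x\<close> of the error is set aside:
        \<open>h >= 1\<close> bounds \<open>(1 / x) ^ k\<close> by \<open>(h / x) ^ k\<close>, while
        \<open>2 ^ k / x\<close> is beaten by \<open>W0\<close>, which is at least of order
        \<open>1 / sqrt x\<close>.\<close>
      also have "\<dots> = ?P * (1 / x) ^ k * (2 ^ k / x)"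
        by (simp add: power_divide mult_ac)
      also have "\<dots> \<le> ?P * (h / x) ^ k * (\<alpha> / 4 * W0)"
      proof (intro mult_mono)
        have "\<alpha> / 4 * (exp (- 1 / 2) / sqrt x) \<le> \<alpha> / 4 * W0"
          using W0(3) \<alpha> by (intro mult_left_mono) auto
        then show "2 ^ k / x \<le> \<alpha> / 4 * W0" using x(2) by linarith
      qed (use P(1) hk(3) \<open>x > 0\<close> in auto)
      also have "\<dots> = Y / 4"
        by (simp add: Y_def T_def)
      finally have err: "\<bar>fdiff (real h) k e v\<bar> \<le> Y / 4" .
      have sum: "fdiff (real h) k ?f v = fdiff (real h) k (window_term x p q) v + fdiff (real h) k e v"
        by (rule fdiff_add)
      \<comment> \<open>The main part is within \<open>Y / 2\<close> of a number of absolute value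
        \<open>Y\<close> and the error is at most \<open>Y / 4\<close>, so the difference lies
        between \<open>Y / 4\<close> and \<open>7 * Y / 4\<close>, which is below
        \<open>s0\<close>.\<close>
      have bounds: "Y / 4 \<le> \<bar>fdiff (real h) k ?f v\<bar>" "\<bar>fdiff (real h) k ?f v\<bar> \<le> s0"
        unfolding sum using main size err Y_upper by linarith+
      have "\<kappa> * (Y / 4)\<^sup>2 \<le> \<kappa> * (fdiff (real h) k ?f v)\<^sup>2"
        using \<open>\<kappa> > 0\<close> \<open>Y > 0\<close> power_mono[OF bounds(1), of 2] by (intro mult_left_mono) auto
      also have "\<dots> \<le> D (fdiff (real h) k ?f v)"
        by (rule quad[OF bounds(2)])
      also have "\<dots> \<le> 4 ^ k * (\<Sum>j\<le>k. D (?f (v + real j * real h)))"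
        by (rule quasi_square_fdiff_le[OF nonneg sub])
      finally show ?thesis .
    qed
    let ?I = "{i. x\<^sup>2 \<le> real i \<and> real i \<le> x\<^sup>2 + r / 2 * x}" and ?J = "{i. x\<^sup>2 \<le> real i \<and> real i \<le> x\<^sup>2 + x}"
    let ?S = "\<Sum>i\<in>?J. D (?f (real i))"
    have "r * x / 4 \<le> real (card ?I)"
    proof -
      have "x * (\<rho> / 2) \<le> x * (r / 2 / 2)"
        using \<rho>(2) \<open>x > 0\<close> by (intro mult_left_mono) auto
      then have "1 \<le> x * (r / 2 / 2)" using x(3) by linarith
      then show ?thesis
        using card_nat_interval_ge[of "x\<^sup>2" "x\<^sup>2 + r / 2 * x"] by (simp add: mult_ac)
    qed
    then have "r * x / 4 * (\<kappa> * (Y / 4)\<^sup>2) \<le> real (card ?I) * (\<kappa> * (Y / 4)\<^sup>2)"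
      using \<open>\<kappa> > 0\<close> by (intro mult_right_mono) auto
    also have "\<dots> = (\<Sum>i\<in>?I. \<kappa> * (Y / 4)\<^sup>2)"
      by simp
    also have "\<dots> \<le> (\<Sum>i\<in>?I. 4 ^ k * (\<Sum>j\<le>k. D (?f (real i + real j * real h))))"
      by (intro sum_mono each) auto
    also have "\<dots> = 4 ^ k * (\<Sum>i\<in>?I. \<Sum>j\<le>k. D (?f (real i + real j * real h)))"
      by (simp add: sum_distrib_left)
    also have "\<dots> \<le> 4 ^ k * (real (Suc k) * ?S)"
    proof (intro mult_left_mono sum_shifted_le[where F = "\<lambda>v. D (?f v)"] nonneg)
      have "r * x \<le> 1 * x" using r \<open>x > 0\<close> by (intro mult_right_mono) auto
      then show "x\<^sup>2 + r / 2 * x + real (k * h) \<le> x\<^sup>2 + x" using kh by simp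
    qed auto
    finally have S: "r * x / 4 * (\<kappa> * (Y / 4)\<^sup>2) \<le> 4 ^ k * real (Suc k) * ?S" by simp
    \<comment> \<open>If \<open>T <= 1\<close>, the lower bound for \<open>W0\<close> gives
      \<open>T^2 >= exp (-1) * P^2 / x\<close>, and the factor \<open>x\<close> from the number of
      starting points cancels the loss; if \<open>T > 1\<close>, the left side is at most
      \<open>x\<close>.\<close>
    have "exp (- 1) * min (?P\<^sup>2) x \<le> x * (min T 1)\<^sup>2"
    proof (cases "T \<le> 1")
      case True
      have "(exp (- 1 / 2) / sqrt x * ?P)\<^sup>2 \<le> T\<^sup>2"
        unfolding T_def using W0(3) P(1) \<open>x > 0\<close> by (intro power_mono mult_right_mono) auto
      moreover have "(exp (- 1 / 2))\<^sup>2 = exp (- 1 :: real)"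
        by (simp flip: exp_double)
      ultimately have "exp (- 1) * ?P\<^sup>2 / x \<le> T\<^sup>2"
        using \<open>x > 0\<close> by (simp add: power_mult_distrib power_divide)
      then have "exp (- 1) * ?P\<^sup>2 \<le> x * T\<^sup>2"
        using \<open>x > 0\<close> by (simp add: pos_divide_le_eq mult.commute)
      moreover have "exp (- 1) * min (?P\<^sup>2) x \<le> exp (- 1) * ?P\<^sup>2"
        by (intro mult_left_mono) auto
      moreover have "min T 1 = T" using True by simp
      ultimately show ?thesis by (metis order_trans)
    next
      case False
      have "exp (- 1) * min (?P\<^sup>2) x \<le> 1 * x"
        using \<open>x > 0\<close> by (intro mult_mono) auto
      then show ?thesis using False by simp
    qed
    then have "c * min (?P\<^sup>2) x \<le> r / 4 * (\<kappa> * (c1 / 4)\<^sup>2) / (4 ^ k * real (Suc k)) * (x * (min T 1)\<^sup>2)"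
      unfolding c_def mult.assoc using r \<open>\<kappa> > 0\<close> by (intro mult_left_mono) auto
    also have "\<dots> = r * x / 4 * (\<kappa> * (c1 * min T 1 / 4)\<^sup>2) / (4 ^ k * real (Suc k))"
      by (simp add: power_mult_distrib power_divide)
    also have "\<dots> \<le> r * x / 4 * (\<kappa> * (Y / 4)\<^sup>2) / (4 ^ k * real (Suc k))"
      using r \<open>x > 0\<close> \<open>\<kappa> > 0\<close> \<open>c1 > 0\<close> \<open>T > 0\<close> Y_lower
      by (intro divide_right_mono mult_left_mono power_mono) auto
    also have "\<dots> \<le> ?S"
      using S by (simp add: pos_divide_le_eq mult_ac del: of_nat_Suc)
    finally show "c * min (?P\<^sup>2) x \<le> ?S" .
  qed (fact \<open>c > 0\<close>)
qed

section \<open>Decay away from the mean and the cross term\<close>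

text \<open>\<open>ln t <= t - 1\<close> at \<open>t = y / sqrt v\<close> and the lower Stirling
  bound combine in the exponent to the complete square \<open>- (sqrt v - y)^2 / 2\<close>.\<close>

lemma poisson_root_le_gauss:
  assumes "y > 0" "v \<ge> 1"
  shows "poisson_root y v \<le> exp (- (sqrt v - y)\<^sup>2 / 2)"
proof -
  have "ln (y / sqrt v) \<le> y / sqrt v - 1"
    using assms by (intro ln_le_minus_one) simp
  then have "v * (ln y - ln v / 2) \<le> v * (y / sqrt v - 1)"
    using assms by (intro mult_left_mono) (auto simp: ln_div ln_sqrt)
  also have "v * (y / sqrt v - 1) = sqrt v * y - v"
  proof -
    have "v * (y / sqrt v) = v / sqrt v * y" by simp
    then show ?thesis
      using assms by (simp only: real_div_sqrt right_diff_distrib)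
  qed
  finally have "v * ln y \<le> sqrt v * y - v + v * ln v / 2"
    by (simp add: right_diff_distrib)
  moreover have "v * ln v - v \<le> ln_Gamma (v + 1)"
    by (rule ln_Gamma_plus1_bounds(1)[OF assms(2)])
  moreover have "(sqrt v - y)\<^sup>2 = v - 2 * (sqrt v * y) + y\<^sup>2"
    using assms by (simp add: power2_diff)
  ultimately show ?thesis
    unfolding poisson_root_def exp_le_cancel_iff by linarith
qed

lemma abs_window_term_le:
  assumes "y > 0" "v \<ge> 1"
  shows "\<bar>window_term y p q v\<bar> \<le> exp (- (sqrt v - y)\<^sup>2 / 2) * (max \<bar>p\<bar> \<bar>q\<bar> * (1 + \<bar>v - y\<^sup>2\<bar> / y))"
proof -
  have "\<bar>p + q * ((v - y\<^sup>2) / y)\<bar> \<le> \<bar>p\<bar> + \<bar>q\<bar> * (\<bar>v - y\<^sup>2\<bar> / y)"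
    using abs_triangle_ineq[of p "q * ((v - y\<^sup>2) / y)"] assms by (simp add: abs_mult)
  also have "\<dots> \<le> max \<bar>p\<bar> \<bar>q\<bar> + max \<bar>p\<bar> \<bar>q\<bar> * (\<bar>v - y\<^sup>2\<bar> / y)"
    using assms by (intro add_mono mult_right_mono) auto
  finally have "\<bar>p + q * ((v - y\<^sup>2) / y)\<bar> \<le> max \<bar>p\<bar> \<bar>q\<bar> * (1 + \<bar>v - y\<^sup>2\<bar> / y)"
    by (simp add: distrib_left)
  then show ?thesis
    unfolding window_term_def abs_mult abs_of_pos[OF poisson_root_pos]
    using poisson_root_le_gauss[OF assms] by (intro mult_mono) auto
qed

text \<open>The exponential is \<open>exp (- M powr (2 * \<epsilon>) / 8)\<close> and beats every
  power of \<open>M\<close>; the other factors on both sides are polynomial.\<close>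

lemma eventually_cross_term_small:
  fixes c1 c2 \<epsilon> :: real
  assumes "0 < c1" "0 < c2" "0 < \<epsilon>"
  shows "\<forall>\<^sub>F M in at_top. exp (- (M powr \<epsilon> / 2)\<^sup>2 / 2) * (1 + (2 * (c2 * M)\<^sup>2 + c2 * M) / (c1 * M)) \<le> 1 / (c2 * M) ^ k"
proof -
  define B where "B = 1 + (2 * c2\<^sup>2 + c2) / c1"
  define d a where "d = 2 * \<epsilon>" and "a = real (Suc k)"
  have "d > 0" using assms by (simp add: d_def)
  then have "((\<lambda>M. exp (- (M powr d) / 8) * M powr a) \<longlongrightarrow> 0) at_top"
    by real_asymp
  then have "((\<lambda>M. B * c2 ^ k * (exp (- (M powr d) / 8) * M powr a)) \<longlongrightarrow> B * c2 ^ k * 0) at_top"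
    by (rule tendsto_mult_left)
  then have "\<forall>\<^sub>F M in at_top. B * c2 ^ k * (exp (- (M powr d) / 8) * M powr a) < 1"
    by (rule order_tendstoD) simp
  then show ?thesis
    using eventually_ge_at_top[of 1]
  proof eventually_elim
    case (elim M)
    let ?E = "exp (- (M powr \<epsilon> / 2)\<^sup>2 / 2)"
    have "(M powr \<epsilon>)\<^sup>2 = M powr d"
      unfolding power2_eq_square powr_add[symmetric] by (simp add: d_def)
    then have E: "?E = exp (- (M powr d) / 8)"
      by (simp add: power_divide)
    have "M powr a = M ^ Suc k"
      unfolding a_def using elim(2) by (intro powr_realpow) simp
    have "(2 * (c2 * M)\<^sup>2 + c2 * M) / (c1 * M) = (2 * c2\<^sup>2 * M + c2) / c1"
      using elim(2) assms by (simp add: field_simps power2_eq_square)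
    also have "\<dots> \<le> (2 * c2\<^sup>2 * M + c2 * M) / c1"
      using elim(2) assms by (intro divide_right_mono add_mono) auto
    finally have "1 + (2 * (c2 * M)\<^sup>2 + c2 * M) / (c1 * M) \<le> B * M"
      using elim(2) by (simp add: B_def algebra_simps add_divide_distrib)
    then have "?E * (1 + (2 * (c2 * M)\<^sup>2 + c2 * M) / (c1 * M)) * (c2 * M) ^ k \<le> ?E * (B * M) * (c2 * M) ^ k"
      using elim(2) assms by (intro mult_right_mono mult_left_mono) auto
    also have "\<dots> = B * c2 ^ k * (?E * M powr a)"
      unfolding \<open>M powr a = _\<close> by (simp add: power_mult_distrib)
    also have "\<dots> \<le> 1"
      using elim(1) unfolding E by simp
    finally show ?case
      using elim(2) assms by (simp add: pos_le_divide_eq)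
  qed
qed

text \<open>The two exponential remainders of the final Gaussian average are at most
  \<open>\<delta> ^ 4\<close> for \<open>\<delta> = M powr - C\<close>.\<close>

lemma eventually_exp_le_powr:
  fixes c C :: real
  assumes "0 < c" "0 < C"
  shows "\<forall>\<^sub>F M in at_top. exp (- c * M / 2) \<le> (M powr - C) ^ 4"
    and "\<forall>\<^sub>F M in at_top. 4 * exp (- M\<^sup>2 / 4) \<le> (M powr - C) ^ 4"
proof -
  define d where "d = 4 * C"
  have "d > 0" using assms by (simp add: d_def)
  have powr: "(M powr - C) ^ 4 = 1 / M powr d" if "M \<ge> 1" for M :: real
  proof -
    have "(M powr - C) ^ 4 = M powr - d"
      using that by (simp add: powr_power d_def mult.commute)
    then show ?thesis by (simp add: powr_minus_divide)
  qed
  have *: "\<forall>\<^sub>F M in at_top. f M \<le> (M powr - C) ^ 4" if "((\<lambda>M. f M * M powr d) \<longlongrightarrow> 0) at_top" for f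
  proof -
    have "\<forall>\<^sub>F M in at_top. f M * M powr d < 1"
      using that by (rule order_tendstoD) simp
    then show ?thesis
      using eventually_ge_at_top[of 1]
    proof eventually_elim
      case (elim M)
      then show ?case by (simp add: powr pos_le_divide_eq)
    qed
  qed
  show "\<forall>\<^sub>F M in at_top. exp (- c * M / 2) \<le> (M powr - C) ^ 4"
    by (rule *) (use \<open>d > 0\<close> \<open>0 < c\<close> in real_asymp)
  show "\<forall>\<^sub>F M in at_top. 4 * exp (- M\<^sup>2 / 4) \<le> (M powr - C) ^ 4"
    by (rule *) (use \<open>d > 0\<close> in real_asymp)
qed

text \<open>On the window of \<open>x\<close> the root \<open>sqrt v\<close> lies between
  \<open>x\<close> and \<open>x + 1 / 2\<close>. As \<open>M powr \<epsilon> >= 1\<close>, it keeps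
  at least half of the separation from \<open>y\<close>.\<close>

lemma abs_window_term_cross_le:
  fixes c1 c2 \<epsilon> M x y p q v :: real
  assumes "0 < c1" "1 \<le> M" "0 < \<epsilon>" "x \<in> {c1 * M..c2 * M}" "y \<in> {c1 * M..c2 * M}" "1 \<le> x"
    and sep: "\<bar>x - y\<bar> \<ge> M powr \<epsilon>" and v: "x\<^sup>2 \<le> v" "v \<le> x\<^sup>2 + x"
  shows "\<bar>window_term y p q v\<bar> \<le> max \<bar>p\<bar> \<bar>q\<bar> *
    (exp (- (M powr \<epsilon> / 2)\<^sup>2 / 2) * (1 + (2 * (c2 * M)\<^sup>2 + c2 * M) / (c1 * M)))"
proof -
  have "1 \<le> v" using v one_le_power[OF \<open>1 \<le> x\<close>, of 2] by linarith
  have "0 < c1 * M" using assms by simp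
  then have "y > 0" "x > 0" using assms(4,5) unfolding atLeastAtMost_iff by linarith+
  have "x \<le> sqrt v" using v \<open>x > 0\<close> by (intro real_le_rsqrt)
  moreover have "sqrt v \<le> x + 1 / 2"
    using v \<open>x > 0\<close> by (intro real_le_lsqrt) (auto simp: power2_sum power_divide)
  moreover have "1 \<le> M powr \<epsilon>" using assms by (intro ge_one_powr_ge_zero) auto
  ultimately have "M powr \<epsilon> / 2 \<le> \<bar>sqrt v - y\<bar>" using sep by linarith
  then have gauss: "exp (- (sqrt v - y)\<^sup>2 / 2) \<le> exp (- (M powr \<epsilon> / 2)\<^sup>2 / 2)"
    using power_mono[of "M powr \<epsilon> / 2" "\<bar>sqrt v - y\<bar>" 2] by simp
  have "x\<^sup>2 \<le> (c2 * M)\<^sup>2" "y\<^sup>2 \<le> (c2 * M)\<^sup>2"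
    using assms \<open>x > 0\<close> \<open>y > 0\<close> by (auto intro!: power_mono)
  then have "\<bar>v - y\<^sup>2\<bar> \<le> 2 * (c2 * M)\<^sup>2 + c2 * M"
  proof -
    have "x \<le> c2 * M" using assms(4) by simp
    then show ?thesis
      unfolding abs_le_iff using \<open>x\<^sup>2 \<le> (c2 * M)\<^sup>2\<close> \<open>y\<^sup>2 \<le> (c2 * M)\<^sup>2\<close> \<open>x > 0\<close> \<open>1 \<le> v\<close> v(2)
        zero_le_power2[of y] by linarith
  qed
  then have poly: "\<bar>v - y\<^sup>2\<bar> / y \<le> (2 * (c2 * M)\<^sup>2 + c2 * M) / (c1 * M)"
    using assms \<open>0 < c1 * M\<close> by (intro frac_le) auto
  have "\<bar>window_term y p q v\<bar> \<le> exp (- (sqrt v - y)\<^sup>2 / 2) * (max \<bar>p\<bar> \<bar>q\<bar> * (1 + \<bar>v - y\<^sup>2\<bar> / y))"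
    by (rule abs_window_term_le[OF \<open>y > 0\<close> \<open>1 \<le> v\<close>])
  also have "\<dots> \<le> exp (- (M powr \<epsilon> / 2)\<^sup>2 / 2) * (max \<bar>p\<bar> \<bar>q\<bar> * (1 + (2 * (c2 * M)\<^sup>2 + c2 * M) / (c1 * M)))"
    using gauss poly \<open>y > 0\<close> by (intro mult_mono mult_left_mono) auto
  finally show ?thesis by (simp add: mult_ac)
qed

section \<open>Lower bound for the exponent over all indices\<close>

text \<open>When the pair at \<open>x\<close> dominates, the window of \<open>x\<close> alone
  suffices and the terms of \<open>y\<close> serve as the error \<open>e\<close> there. The order of
  difference is even or odd according to which of \<open>p\<close>, \<open>q\<close> is
  larger.\<close>

lemma one_sided_exponent_lower:
  fixes D :: "real \<Rightarrow> real" and C \<kappa> s0 c1 c2 \<epsilon> :: real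
  assumes nonneg: "\<And>s. 0 \<le> D s" and sub: "\<And>s t. D (s - t) \<le> 2 * D s + 2 * D t"
    and quad: "\<And>s. \<bar>s\<bar> \<le> s0 \<Longrightarrow> \<kappa> * s\<^sup>2 \<le> D s" and pos: "s0 > 0" "\<kappa> > 0"
    and "0 < C" "0 < c1" "c1 < c2" "0 < \<epsilon>"
  obtains c M0 where "c > 0" "M0 \<ge> 1"
    "\<And>M (n::nat) x y p q p' q'. M \<ge> M0 \<Longrightarrow> c2 * M \<le> sqrt n - M \<Longrightarrow> x \<in> {c1 * M..c2 * M} \<Longrightarrow> y \<in> {c1 * M..c2 * M} \<Longrightarrow>
      \<bar>x - y\<bar> \<ge> M powr \<epsilon> \<Longrightarrow> max \<bar>p\<bar> \<bar>q\<bar> \<le> M powr C \<Longrightarrow> max \<bar>p'\<bar> \<bar>q'\<bar> \<le> max \<bar>p\<bar> \<bar>q\<bar> \<Longrightarrow>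
      c * min ((max \<bar>p\<bar> \<bar>q\<bar>)\<^sup>2) M \<le> (\<Sum>i=1..n. D (window_term x p q (real i) + window_term y p' q' (real i)))"
proof -
  \<comment> \<open>The window bound needs coefficients bounded by a power of \<open>x\<close>.
    Since \<open>M <= x^2\<close> for large \<open>M\<close>, the exponent \<open>C\<close> becomes
    \<open>2 * C\<close>, without a constant depending on \<open>c1\<close>.\<close>
  obtain k0 :: nat where "2 * C < real k0" using reals_Archimedean2 by blast
  define k where "k = (\<lambda>b. if b then 2 * (k0 + 1) else Suc (2 * (k0 + 1)))"
  have k: "k b \<ge> 1" "2 * C < real (k b)" "even (k b) = b" for b
    using \<open>2 * C < real k0\<close> by (auto simp: k_def)
  define window_bound where "window_bound = (\<lambda>b c X. \<forall>x p q e. x \<ge> X \<longrightarrow> (if b then \<bar>q\<bar> \<le> \<bar>p\<bar> else \<bar>p\<bar> \<le> \<bar>q\<bar>) \<longrightarrow>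
      0 < max \<bar>p\<bar> \<bar>q\<bar> \<longrightarrow> max \<bar>p\<bar> \<bar>q\<bar> \<le> x powr (2 * C) \<longrightarrow>
      (\<forall>v. x\<^sup>2 \<le> v \<longrightarrow> v \<le> x\<^sup>2 + x \<longrightarrow> \<bar>e v\<bar> \<le> max \<bar>p\<bar> \<bar>q\<bar> / x ^ Suc (k b)) \<longrightarrow>
      c * min ((max \<bar>p\<bar> \<bar>q\<bar>)\<^sup>2) x \<le> (\<Sum>i | x\<^sup>2 \<le> real i \<and> real i \<le> x\<^sup>2 + x. D (window_term x p q (real i) + e (real i))))"
  have "\<exists>c X. c > 0 \<and> window_bound b c X" for b
  proof (rule window_sum_lower[OF nonneg sub quad pos k(1,2)[of b]])
    fix c X :: real
    assume "c > 0" and *: "\<And>x p q e. x \<ge> X \<Longrightarrow> (if even (k b) then \<bar>q\<bar> \<le> \<bar>p\<bar> else \<bar>p\<bar> \<le> \<bar>q\<bar>) \<Longrightarrow>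
      0 < max \<bar>p\<bar> \<bar>q\<bar> \<Longrightarrow> max \<bar>p\<bar> \<bar>q\<bar> \<le> x powr (2 * C) \<Longrightarrow>
      (\<And>v. x\<^sup>2 \<le> v \<Longrightarrow> v \<le> x\<^sup>2 + x \<Longrightarrow> \<bar>e v\<bar> \<le> max \<bar>p\<bar> \<bar>q\<bar> / x ^ Suc (k b)) \<Longrightarrow>
      c * min ((max \<bar>p\<bar> \<bar>q\<bar>)\<^sup>2) x \<le> (\<Sum>i | x\<^sup>2 \<le> real i \<and> real i \<le> x\<^sup>2 + x. D (window_term x p q (real i) + e (real i)))"
    have "window_bound b c X"
      unfolding window_bound_def by (intro allI impI *) (simp_all only: k(3))
    with \<open>c > 0\<close> show ?thesis by blast
  qed
  then obtain c0 X where c0: "\<And>b. c0 b > (0::real)" and window: "\<And>b. window_bound b (c0 b) (X b)"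
    by metis
  have "0 < c2" using assms by simp
  have "\<forall>\<^sub>F M in at_top. \<forall>b\<in>UNIV. exp (- (M powr \<epsilon> / 2)\<^sup>2 / 2) * (1 + (2 * (c2 * M)\<^sup>2 + c2 * M) / (c1 * M)) \<le> 1 / (c2 * M) ^ Suc (k b)"
    by (intro eventually_ball_finite ballI eventually_cross_term_small assms \<open>0 < c2\<close>) simp
  then obtain M1 where M1: "\<And>M b. M \<ge> M1 \<Longrightarrow> exp (- (M powr \<epsilon> / 2)\<^sup>2 / 2) * (1 + (2 * (c2 * M)\<^sup>2 + c2 * M) / (c1 * M)) \<le> 1 / (c2 * M) ^ Suc (k b)"
    unfolding eventually_at_top_linorder by blast
  \<comment> \<open>Apart from the thresholds of the earlier bounds, \<open>1 / c1\<close> ensures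
    \<open>x >= 1\<close>, and \<open>1 / c1 / c1\<close> ensures \<open>x >= 1 / c1\<close> and
    hence \<open>M <= x / c1 <= x^2\<close>.\<close>
  define M0 where "M0 = Max {1, M1, X True / c1, X False / c1, 1 / c1, 1 / c1 / c1}"
  \<comment> \<open>The first factor serves both parities; \<open>min 1 c1\<close> replaces
    \<open>x >= c1 * M\<close> by \<open>M\<close> in the minimum.\<close>
  define c where "c = min (c0 True) (c0 False) * min 1 c1"
  have "c > 0" using c0 \<open>0 < c1\<close> by (simp add: c_def)
  show ?thesis
  proof (rule that[of c M0])
    show "M0 \<ge> 1" unfolding M0_def by (rule Max_ge) auto
    fix M :: real and n :: nat and x y p q p' q' :: real
    let ?P = "max \<bar>p\<bar> \<bar>q\<bar>"
    let ?e = "\<lambda>v. window_term y p' q' v"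
    assume "M \<ge> M0" and n: "c2 * M \<le> sqrt n - M" and x: "x \<in> {c1 * M..c2 * M}" and y: "y \<in> {c1 * M..c2 * M}"
      and sep: "\<bar>x - y\<bar> \<ge> M powr \<epsilon>" and P: "?P \<le> M powr C" and P': "max \<bar>p'\<bar> \<bar>q'\<bar> \<le> ?P"
    have M: "M \<ge> 1" "M \<ge> M1" "M \<ge> X True / c1" "M \<ge> X False / c1" "M \<ge> 1 / c1" "M \<ge> 1 / c1 / c1"
      using \<open>M \<ge> M0\<close> by (auto simp: M0_def)
    have cM: "X True \<le> c1 * M" "X False \<le> c1 * M" "1 \<le> c1 * M" "1 / c1 \<le> c1 * M"
      using M(3-6) unfolding mult.commute[of c1 M] pos_divide_le_eq[OF \<open>0 < c1\<close>, of _ M] .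
    have x': "x \<ge> 1" "1 / c1 \<le> x" "x > 0"
      using cM x by auto
    have X: "X b \<le> x" for b
      using cM(1,2) x by (cases b) auto
    let ?J = "{i. x\<^sup>2 \<le> real i \<and> real i \<le> x\<^sup>2 + x}"
    show "c * min (?P\<^sup>2) M \<le> (\<Sum>i=1..n. D (window_term x p q (real i) + ?e (real i)))"
    proof (cases "?P = 0")
      case True
      have "min (?P\<^sup>2) M = 0" unfolding True using M(1) by simp
      then show ?thesis using nonneg by (simp add: sum_nonneg)
    next
      case False
      define b where "b = (\<bar>q\<bar> \<le> \<bar>p\<bar>)"
      have "c0 b * min (?P\<^sup>2) x \<le> (\<Sum>i\<in>?J. D (window_term x p q (real i) + ?e (real i)))"
      proof (rule window[of b, unfolded window_bound_def, rule_format])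
        show "X b \<le> x" by (rule X)
        show "if b then \<bar>q\<bar> \<le> \<bar>p\<bar> else \<bar>p\<bar> \<le> \<bar>q\<bar>" by (auto simp: b_def)
        show "0 < ?P" using False abs_ge_zero[of p] by linarith
        have "M \<le> x / c1" using x \<open>0 < c1\<close> by (simp add: pos_le_divide_eq mult.commute)
        also have "\<dots> \<le> x * x" using x' mult_left_mono[of "1 / c1" x x] by simp
        finally have "M powr C \<le> (x * x) powr C"
          using M \<open>0 < C\<close> by (intro powr_mono2) auto
        also have "\<dots> = x powr (2 * C)"
          using x' by (simp add: powr_mult flip: powr_add)
        finally show "?P \<le> x powr (2 * C)" using P by linarith
        fix v assume v: "x\<^sup>2 \<le> v" "v \<le> x\<^sup>2 + x"
        have "\<bar>?e v\<bar> \<le> max \<bar>p'\<bar> \<bar>q'\<bar> * (exp (- (M powr \<epsilon> / 2)\<^sup>2 / 2) * (1 + (2 * (c2 * M)\<^sup>2 + c2 * M) / (c1 * M)))"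
          using assms M(1) x y x'(1) sep v by (intro abs_window_term_cross_le) auto
        also have "\<dots> \<le> ?P * (1 / (c2 * M) ^ Suc (k b))"
          using P' M1[OF M(2)] M(1) \<open>0 < c1\<close> \<open>0 < c2\<close> by (intro mult_mono) auto
        also have "\<dots> \<le> ?P * (1 / x ^ Suc (k b))"
          using x x' \<open>0 < c2\<close> M(1) by (intro mult_left_mono divide_left_mono power_mono mult_pos_pos zero_less_power) auto
        finally show "\<bar>?e v\<bar> \<le> ?P / x ^ Suc (k b)" by simp
      qed
      also have "\<dots> \<le> (\<Sum>i=1..n. D (window_term x p q (real i) + ?e (real i)))"
      proof (rule sum_mono2)
        \<comment> \<open>The distance \<open>M\<close> from \<open>sqrt n\<close> keeps the whole
          window among the indices: \<open>n >= (x + M)^2 >= x^2 + x\<close>.\<close>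
        have "x + M \<le> sqrt n" using x n by auto
        then have "(x + M)\<^sup>2 \<le> (sqrt n)\<^sup>2" using x' M by (intro power_mono) auto
        then have "x\<^sup>2 + M\<^sup>2 + 2 * (x * M) \<le> real n" by (simp add: power2_sum)
        moreover have "x * 1 \<le> x * M" using M(1) x' by (intro mult_left_mono) auto
        ultimately have "x\<^sup>2 + x \<le> real n"
          using x'(3) zero_le_power2[of M] by linarith
        moreover have "1 \<le> x\<^sup>2" using x'(1) by simp
        ultimately show "?J \<subseteq> {1..n}" by auto
      qed (use nonneg in auto)
      finally have main: "c0 b * min (?P\<^sup>2) x \<le> (\<Sum>i=1..n. D (window_term x p q (real i) + ?e (real i)))" .
      have "min 1 c1 * min (?P\<^sup>2) M \<le> min (?P\<^sup>2) x"
      proof (rule min.boundedI)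
        show "min 1 c1 * min (?P\<^sup>2) M \<le> ?P\<^sup>2"
          using \<open>0 < c1\<close> M(1) mult_mono[of "min 1 c1" 1 "min (?P\<^sup>2) M" "?P\<^sup>2"] by simp
        show "min 1 c1 * min (?P\<^sup>2) M \<le> x"
          using \<open>0 < c1\<close> M(1) x mult_mono[of "min 1 c1" c1 "min (?P\<^sup>2) M" M] by auto
      qed
      then have "c * min (?P\<^sup>2) M \<le> min (c0 True) (c0 False) * min (?P\<^sup>2) x"
        unfolding c_def mult.assoc using c0 by (intro mult_left_mono) (auto simp: less_imp_le)
      also have "\<dots> \<le> c0 b * min (?P\<^sup>2) x"
        using x' by (intro mult_right_mono) (cases b; auto)+
      finally show ?thesis using main by linarith
    qed
  qed (fact \<open>c > 0\<close>)
qed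

text \<open>The roles of \<open>x\<close> and \<open>y\<close> are symmetric, so the dominating pair
  may be put first; its larger entry squared is at least a quarter of the sum of all four
  squares.\<close>

lemma exponent_lower:
  fixes D :: "real \<Rightarrow> real" and C \<kappa> s0 c1 c2 \<epsilon> :: real
  assumes nonneg: "\<And>s. 0 \<le> D s" and sub: "\<And>s t. D (s - t) \<le> 2 * D s + 2 * D t"
    and quad: "\<And>s. \<bar>s\<bar> \<le> s0 \<Longrightarrow> \<kappa> * s\<^sup>2 \<le> D s" and pos: "s0 > 0" "\<kappa> > 0"
    and "0 < C" "0 < c1" "c1 < c2" "0 < \<epsilon>"
  obtains c M0 where "c > 0" "M0 \<ge> 1"
    "\<And>M (n::nat) x y p q p' q'. M \<ge> M0 \<Longrightarrow> c2 * M \<le> sqrt n - M \<Longrightarrow> x \<in> {c1 * M..c2 * M} \<Longrightarrow> y \<in> {c1 * M..c2 * M} \<Longrightarrow>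
      \<bar>x - y\<bar> \<ge> M powr \<epsilon> \<Longrightarrow> p\<^sup>2 + q\<^sup>2 + p'\<^sup>2 + q'\<^sup>2 \<le> (M powr C)\<^sup>2 \<Longrightarrow>
      c * min (p\<^sup>2 + q\<^sup>2 + p'\<^sup>2 + q'\<^sup>2) M \<le> (\<Sum>i=1..n. D (window_term x p q (real i) + window_term y p' q' (real i)))"
proof (rule one_sided_exponent_lower[OF assms])
  fix c M0 :: real
  assume "c > 0" "M0 \<ge> 1" and one_sided:
    "\<And>M (n::nat) x y p q p' q'. M \<ge> M0 \<Longrightarrow> c2 * M \<le> sqrt n - M \<Longrightarrow> x \<in> {c1 * M..c2 * M} \<Longrightarrow> y \<in> {c1 * M..c2 * M} \<Longrightarrow>
      \<bar>x - y\<bar> \<ge> M powr \<epsilon> \<Longrightarrow> max \<bar>p\<bar> \<bar>q\<bar> \<le> M powr C \<Longrightarrow> max \<bar>p'\<bar> \<bar>q'\<bar> \<le> max \<bar>p\<bar> \<bar>q\<bar> \<Longrightarrow>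
      c * min ((max \<bar>p\<bar> \<bar>q\<bar>)\<^sup>2) M \<le> (\<Sum>i=1..n. D (window_term x p q (real i) + window_term y p' q' (real i)))"
  have ordered: "c / 4 * min (p\<^sup>2 + q\<^sup>2 + p'\<^sup>2 + q'\<^sup>2) M \<le> (\<Sum>i=1..n. D (window_term x p q (real i) + window_term y p' q' (real i)))"
    if "M \<ge> M0" "c2 * M \<le> sqrt n - M" "x \<in> {c1 * M..c2 * M}" "y \<in> {c1 * M..c2 * M}"
      "\<bar>x - y\<bar> \<ge> M powr \<epsilon>" and norm: "p\<^sup>2 + q\<^sup>2 + p'\<^sup>2 + q'\<^sup>2 \<le> (M powr C)\<^sup>2" and le: "max \<bar>p'\<bar> \<bar>q'\<bar> \<le> max \<bar>p\<bar> \<bar>q\<bar>"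
    for M x y p q p' q' and n :: nat
  proof -
    let ?P = "max \<bar>p\<bar> \<bar>q\<bar>"
    note nonneg_squares = zero_le_power2[of p] zero_le_power2[of q] zero_le_power2[of p'] zero_le_power2[of q']
    have "p\<^sup>2 \<le> (M powr C)\<^sup>2" "q\<^sup>2 \<le> (M powr C)\<^sup>2"
      using norm nonneg_squares by linarith+
    then have "?P \<le> M powr C"
      unfolding abs_le_square_iff[symmetric] by simp
    have "\<bar>?P\<bar> = ?P" by simp
    then have *: "v\<^sup>2 \<le> ?P\<^sup>2" if "\<bar>v\<bar> \<le> ?P" for v
      using that abs_le_square_iff[of v ?P] by metis
    have "p\<^sup>2 \<le> ?P\<^sup>2" "q\<^sup>2 \<le> ?P\<^sup>2" "p'\<^sup>2 \<le> ?P\<^sup>2" "q'\<^sup>2 \<le> ?P\<^sup>2"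
      by (rule *; use le in simp)+
    then have "p\<^sup>2 + q\<^sup>2 + p'\<^sup>2 + q'\<^sup>2 \<le> 4 * ?P\<^sup>2"
      by linarith
    moreover have "M \<ge> 0" using that(1) \<open>M0 \<ge> 1\<close> by simp
    moreover have "min S m \<le> 4 * min R m" if "S \<le> 4 * R" "0 \<le> m" for S R m :: real
      using that by (simp add: min_def)
    ultimately have "min (p\<^sup>2 + q\<^sup>2 + p'\<^sup>2 + q'\<^sup>2) M \<le> 4 * min (?P\<^sup>2) M"
      by blast
    then have "c / 4 * min (p\<^sup>2 + q\<^sup>2 + p'\<^sup>2 + q'\<^sup>2) M \<le> c / 4 * (4 * min (?P\<^sup>2) M)"
      using \<open>c > 0\<close> by (intro mult_left_mono) auto
    also have "\<dots> = c * min (?P\<^sup>2) M" by simp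
    also note one_sided[OF that(1-5) \<open>?P \<le> M powr C\<close> le]
    finally show ?thesis .
  qed
  show ?thesis
  proof (rule that[of "c / 4" M0])
    fix M :: real and n :: nat and x y p q p' q' :: real
    assume *: "M \<ge> M0" "c2 * M \<le> sqrt n - M" "x \<in> {c1 * M..c2 * M}" "y \<in> {c1 * M..c2 * M}"
      "\<bar>x - y\<bar> \<ge> M powr \<epsilon>" "p\<^sup>2 + q\<^sup>2 + p'\<^sup>2 + q'\<^sup>2 \<le> (M powr C)\<^sup>2"
    show "c / 4 * min (p\<^sup>2 + q\<^sup>2 + p'\<^sup>2 + q'\<^sup>2) M \<le> (\<Sum>i=1..n. D (window_term x p q (real i) + window_term y p' q' (real i)))"
    proof (cases "max \<bar>p'\<bar> \<bar>q'\<bar> \<le> max \<bar>p\<bar> \<bar>q\<bar>")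
      case True
      then show ?thesis by (rule ordered[OF *])
    next
      case False
      then have le: "max \<bar>p\<bar> \<bar>q\<bar> \<le> max \<bar>p'\<bar> \<bar>q'\<bar>" by linarith
      have sep: "\<bar>y - x\<bar> \<ge> M powr \<epsilon>" and norm: "p'\<^sup>2 + q'\<^sup>2 + p\<^sup>2 + q\<^sup>2 \<le> (M powr C)\<^sup>2"
        using *(5,6) by linarith+
      have "c / 4 * min (p'\<^sup>2 + q'\<^sup>2 + p\<^sup>2 + q\<^sup>2) M
          \<le> (\<Sum>i=1..n. D (window_term y p' q' (real i) + window_term x p q (real i)))"
        by (rule ordered[OF *(1,2,4,3) sep norm le])
      then show ?thesis by (simp only: add_ac)
    qed
  qed (use \<open>c > 0\<close> \<open>M0 \<ge> 1\<close> in auto)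
qed

section \<open>Characteristic functions and small balls\<close>

text \<open>\<open>\<bar>\<phi>\<bar>^2\<close> is the characteristic function of the difference of
  two independent copies, so it is real and phases disappear.\<close>

definition sym_char_defect :: "real measure \<Rightarrow> real \<Rightarrow> real" where
  "sym_char_defect M s = 1 - (cmod (char M s))\<^sup>2"

text \<open>As a mean of \<open>1 - cos\<close> the defect inherits pointwise inequalities; the
  addition formula for \<open>cos (s * (x - y))\<close> and Fubini produce the two squares of
  \<open>\<bar>\<phi>\<bar>^2\<close>.\<close>

lemma (in real_distribution) sym_char_defect_eq:
  "sym_char_defect M s = (\<integral>z. 1 - cos (s * (fst z - snd z)) \<partial>(M \<Otimes>\<^sub>M M))"
proof -
  interpret P: pair_prob_space M M ..
  have [measurable_cong]: "sets M = sets borel" by simp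
  have int: "integrable M (\<lambda>x. cos (s * x))" "integrable M (\<lambda>x. sin (s * x))"
    by (intro integrable_const_bound[where B = 1]; simp)+
  have iexp: "integrable M (\<lambda>x. iexp (s * x))"
    by (rule integrable_iexp) auto
  have Re: "Re (char M s) = (\<integral>x. cos (s * x) \<partial>M)" and Im: "Im (char M s) = (\<integral>x. sin (s * x) \<partial>M)"
    unfolding char_def using integral_Re[OF iexp] integral_Im[OF iexp] by (simp_all add: Re_exp Im_exp)
  have "integrable (M \<Otimes>\<^sub>M M) (\<lambda>z. cos (s * (fst z - snd z)))"
    by (intro P.integrable_const_bound[where B = 1]) auto
  then have "(\<integral>z. cos (s * (fst z - snd z)) \<partial>(M \<Otimes>\<^sub>M M)) = (\<integral>x. \<integral>y. cos (s * (x - y)) \<partial>M \<partial>M)"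
    using P.integral_fst'[of "\<lambda>z. cos (s * (fst z - snd z))"] by simp
  also have "\<dots> = (\<integral>x. cos (s * x) * (\<integral>y. cos (s * y) \<partial>M) + sin (s * x) * (\<integral>y. sin (s * y) \<partial>M) \<partial>M)"
    using int by (intro Bochner_Integration.integral_cong refl) (simp add: right_diff_distrib cos_diff)
  also have "\<dots> = (\<integral>x. cos (s * x) \<partial>M)\<^sup>2 + (\<integral>x. sin (s * x) \<partial>M)\<^sup>2"
    using int by (simp add: power2_eq_square)
  also have "\<dots> = (cmod (char M s))\<^sup>2"
    by (simp add: cmod_power2 Re Im)
  finally have "(\<integral>z. cos (s * (fst z - snd z)) \<partial>(M \<Otimes>\<^sub>M M)) = (cmod (char M s))\<^sup>2" .
  then show ?thesis
    using \<open>integrable (M \<Otimes>\<^sub>M M) (\<lambda>z. cos (s * (fst z - snd z)))\<close>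
    by (simp add: sym_char_defect_def P.prob_space)
qed

lemma (in real_distribution) sym_char_defect_nonneg: "0 \<le> sym_char_defect M s"
  using cmod_char_le_1[of s] by (simp add: sym_char_defect_def power_le_one)

text \<open>\<open>1 - cos c\<close> is \<open>2 * (sin (c / 2))^2\<close>, and
  \<open>\<bar>sin\<bar>\<close> is subadditive.\<close>

lemma one_minus_cos_diff_le: "1 - cos (a - b) \<le> 2 * (1 - cos a) + 2 * (1 - cos (b::real))"
proof -
  have sq: "1 - cos c = 2 * (sin (c / 2))\<^sup>2" for c :: real
    using cos_double_sin[of "c / 2"] by simp
  have "\<bar>sin ((a - b) / 2)\<bar> \<le> \<bar>sin (a / 2)\<bar> * \<bar>cos (b / 2)\<bar> + \<bar>cos (a / 2)\<bar> * \<bar>sin (b / 2)\<bar>"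
    using abs_triangle_ineq4[of "sin (a / 2) * cos (b / 2)" "cos (a / 2) * sin (b / 2)"]
    by (simp add: diff_divide_distrib sin_diff abs_mult)
  also have "\<dots> \<le> \<bar>sin (a / 2)\<bar> * 1 + 1 * \<bar>sin (b / 2)\<bar>"
    by (intro add_mono mult_mono) auto
  finally have "(sin ((a - b) / 2))\<^sup>2 \<le> (\<bar>sin (a / 2)\<bar> + \<bar>sin (b / 2)\<bar>)\<^sup>2"
    using power_mono[of "\<bar>sin ((a - b) / 2)\<bar>" _ 2] by simp
  also have "\<dots> \<le> 2 * (sin (a / 2))\<^sup>2 + 2 * (sin (b / 2))\<^sup>2"
    using sum_squares_bound[of "\<bar>sin (a / 2)\<bar>" "\<bar>sin (b / 2)\<bar>"] by (simp add: power2_sum)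
  finally show ?thesis unfolding sq by simp
qed

lemma (in real_distribution) sym_char_defect_diff_le:
  "sym_char_defect M (s - t) \<le> 2 * sym_char_defect M s + 2 * sym_char_defect M t"
proof -
  interpret P: pair_prob_space M M ..
  have [measurable_cong]: "sets M = sets borel" by simp
  have int: "integrable (M \<Otimes>\<^sub>M M) (\<lambda>z. 1 - cos (u * (fst z - snd z)))" for u
  proof (intro P.integrable_const_bound[where B = 2])
    show "AE z in M \<Otimes>\<^sub>M M. norm (1 - cos (u * (fst z - snd z))) \<le> 2"
    proof (rule AE_I2)
      fix z :: "real \<times> real"
      show "norm (1 - cos (u * (fst z - snd z))) \<le> 2"
        using cos_ge_minus_one[of "u * (fst z - snd z)"] cos_le_one[of "u * (fst z - snd z)"] by simp
    qed
  qed auto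
  have "sym_char_defect M (s - t) \<le> (\<integral>z. 2 * (1 - cos (s * (fst z - snd z))) + 2 * (1 - cos (t * (fst z - snd z))) \<partial>(M \<Otimes>\<^sub>M M))"
    unfolding sym_char_defect_eq
  proof (rule integral_mono)
    fix z :: "real \<times> real"
    show "1 - cos ((s - t) * (fst z - snd z)) \<le> 2 * (1 - cos (s * (fst z - snd z))) + 2 * (1 - cos (t * (fst z - snd z)))"
      unfolding left_diff_distrib[of s t] by (rule one_minus_cos_diff_le)
  qed (intro int Bochner_Integration.integrable_add Bochner_Integration.integrable_mult_right)+
  also have "\<dots> = 2 * sym_char_defect M s + 2 * sym_char_defect M t"
    unfolding sym_char_defect_eq
    using Bochner_Integration.integral_add[OF integrable_mult_right[OF int, of 2] integrable_mult_right[OF int, of 2], of s t]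
    by (simp only: integral_mult_right_zero)
  finally show ?thesis .
qed

text \<open>The second order expansion \<open>1 - s^2 / 2\<close> has error
  \<open>s^2 / 6 * e s\<close>, where \<open>e\<close> tends to 0 by dominated convergence.\<close>

lemma (in real_distribution) sym_char_defect_ge_quadratic:
  assumes "integrable M (\<lambda>x. x)" "integrable M (\<lambda>x. x\<^sup>2)"
    and "expectation (\<lambda>x. x) = 0" "expectation (\<lambda>x. x\<^sup>2) = 1"
  obtains s0 where "s0 > 0" "\<And>s. \<bar>s\<bar> \<le> s0 \<Longrightarrow> s\<^sup>2 / 4 \<le> sym_char_defect M s"
proof -
  define e where "e = (\<lambda>t. expectation (\<lambda>x. min (6 * x\<^sup>2) (\<bar>t\<bar> * \<bar>x\<bar> ^ 3)))"
  have meas: "(\<lambda>x. min (6 * x\<^sup>2) (\<bar>t\<bar> * \<bar>x\<bar> ^ 3)) \<in> borel_measurable M" for t :: real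
    by measurable
  have int: "integrable M (\<lambda>x. min (6 * x\<^sup>2) (\<bar>t\<bar> * \<bar>x\<bar> ^ 3))" for t :: real
    using assms(2) by (intro Bochner_Integration.integrable_bound[where f = "\<lambda>x. 6 * x\<^sup>2", OF _ meas]) auto
  have "(\<lambda>n. e (1 / real (Suc n))) \<longlonglongrightarrow> expectation (\<lambda>x. 0)"
    unfolding e_def
  proof (rule integral_dominated_convergence[where w = "\<lambda>x. 6 * x\<^sup>2"])
    show "AE x in M. (\<lambda>n. min (6 * x\<^sup>2) (\<bar>1 / real (Suc n)\<bar> * \<bar>x\<bar> ^ 3)) \<longlonglongrightarrow> 0"
    proof (rule AE_I2)
      fix x :: real
      have "(\<lambda>n. min (6 * x\<^sup>2) (\<bar>1 / real (Suc n)\<bar> * \<bar>x\<bar> ^ 3)) \<longlonglongrightarrow> min (6 * x\<^sup>2) (\<bar>0\<bar> * \<bar>x\<bar> ^ 3)"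
        by (intro tendsto_intros) real_asymp
      then show "(\<lambda>n. min (6 * x\<^sup>2) (\<bar>1 / real (Suc n)\<bar> * \<bar>x\<bar> ^ 3)) \<longlonglongrightarrow> 0" by simp
    qed
    show "AE x in M. norm (min (6 * x\<^sup>2) (\<bar>1 / real (Suc n)\<bar> * \<bar>x\<bar> ^ 3)) \<le> 6 * x\<^sup>2" for n
      by (rule AE_I2) (simp del: of_nat_Suc)
    show "(\<lambda>x. min (6 * x\<^sup>2) (\<bar>1 / real (Suc n)\<bar> * \<bar>x\<bar> ^ 3)) \<in> borel_measurable M" for n
      by (rule meas)
    show "integrable M (\<lambda>x. 6 * x\<^sup>2)"
      using assms(2) by (rule integrable_mult_right)
  qed simp
  \<comment> \<open>One scale with \<open>e < 1\<close> is enough, because \<open>e\<close> is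
    monotone in \<open>\<bar>t\<bar>\<close>.\<close>
  then have "\<forall>\<^sub>F n in sequentially. e (1 / real (Suc n)) < 1"
    by (intro order_tendstoD(2)) auto
  then obtain n where n: "e (1 / real (Suc n)) < 1"
    by (auto simp: eventually_sequentially)
  define s0 where "s0 = min 1 (1 / real (Suc n))"
  show ?thesis
  proof (rule that)
    show "s0 > 0" by (simp add: s0_def)
    fix s :: real assume s: "\<bar>s\<bar> \<le> s0"
    have "e s \<le> e (1 / real (Suc n))"
      unfolding e_def using s by (intro integral_mono int min.mono mult_right_mono) (auto simp: s0_def)
    then have "e s \<le> 1" using n by simp
    have "cmod (char M s - (1 - s\<^sup>2 * 1 / 2)) \<le> (s\<^sup>2 / 6) * e s"
      unfolding e_def using assms by (intro char_approx3) auto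
    also have "\<dots> \<le> s\<^sup>2 / 6 * 1"
      using \<open>e s \<le> 1\<close> by (intro mult_left_mono) auto
    finally have "cmod (char M s - of_real (1 - s\<^sup>2 / 2)) \<le> s\<^sup>2 / 6"
      by simp
    moreover have "s\<^sup>2 \<le> 1"
    proof -
      have "s0 \<le> 1" by (simp add: s0_def)
      then show ?thesis using s unfolding abs_square_le_1 by linarith
    qed
    moreover have "cmod (char M s) \<le> cmod (char M s - of_real (1 - s\<^sup>2 / 2)) + cmod (of_real (1 - s\<^sup>2 / 2))"
      by (metis norm_triangle_sub add.commute)
    ultimately have le: "cmod (char M s) \<le> 1 - s\<^sup>2 / 3"
      unfolding norm_of_real by simp
    \<comment> \<open>Dropping the square gives
      \<open>D s >= 1 - \<bar>\<phi> s\<bar> >= s^2 / 3\<close>.\<close>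
    have "(cmod (char M s))\<^sup>2 \<le> cmod (char M s)"
      using cmod_char_le_1[of s] by (simp add: power2_eq_square mult_left_le)
    then show "s\<^sup>2 / 4 \<le> sym_char_defect M s"
      using le zero_le_power2[of s] unfolding sym_char_defect_def by linarith
  qed
qed

lemma (in real_distribution) cmod_char_le_exp: "cmod (char M s) \<le> exp (- sym_char_defect M s / 2)"
proof -
  have "(cmod (char M s))\<^sup>2 \<le> exp (- sym_char_defect M s)"
    using exp_ge_add_one_self[of "- sym_char_defect M s"] by (simp add: sym_char_defect_def)
  also have "\<dots> = (exp (- sym_char_defect M s / 2))\<^sup>2"
    by (simp flip: exp_double)
  finally show ?thesis by (rule power2_le_imp_le) simp
qed

section \<open>Gaussian averages of characters\<close>

text \<open>The integrand is \<open>\<sigma>\<close> times the normal density of variance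
  \<open>1 / (1 + 2 * s)\<close>. Negative \<open>s\<close> is included because the tail estimate
  uses \<open>s = -1/4\<close>.\<close>

lemma std_normal_exp_square:
  assumes "s > - (1 / 2)"
  shows "integrable std_normal_distribution (\<lambda>x. exp (- s * x\<^sup>2))"
    and "(\<integral>x. exp (- s * x\<^sup>2) \<partial>std_normal_distribution) = 1 / sqrt (1 + 2 * s)"
proof -
  define \<sigma> where "\<sigma> = 1 / sqrt (1 + 2 * s)"
  have \<sigma>: "\<sigma> > 0" "\<sigma>\<^sup>2 = 1 / (1 + 2 * s)"
    using assms by (simp_all add: \<sigma>_def power_divide)
  have eq: "std_normal_density x * exp (- s * x\<^sup>2) = \<sigma> * normal_density 0 \<sigma> x" for x
  proof -
    have "std_normal_density x * exp (- s * x\<^sup>2) = 1 / sqrt (2 * pi) * exp (- x\<^sup>2 / 2 - s * x\<^sup>2)"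
      by (simp add: std_normal_density_def flip: exp_add)
    also have "- x\<^sup>2 / 2 - s * x\<^sup>2 = - x\<^sup>2 / (2 * \<sigma>\<^sup>2)"
      using assms by (simp add: \<sigma> field_simps)
    also have "1 / sqrt (2 * pi) = \<sigma> * (1 / sqrt (2 * pi * \<sigma>\<^sup>2))"
      using \<sigma>(1) by (simp add: real_sqrt_mult)
    finally show ?thesis by (simp add: normal_density_def)
  qed
  have int: "integrable lborel (\<lambda>x. std_normal_density x * exp (- s * x\<^sup>2))"
    unfolding eq using integrable_normal_density[OF \<sigma>(1)] by simp
  then show "integrable std_normal_distribution (\<lambda>x. exp (- s * x\<^sup>2))"
    by (subst integrable_density) (auto simp: normal_density_nonneg)
  have "(\<integral>x. exp (- s * x\<^sup>2) \<partial>std_normal_distribution) = (\<integral>x. std_normal_density x * exp (- s * x\<^sup>2) \<partial>lborel)"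
    by (subst integral_density) (auto simp: normal_density_nonneg)
  also have "\<dots> = \<sigma>"
    unfolding eq using integral_normal_density[OF \<sigma>(1)] by simp
  finally show "(\<integral>x. exp (- s * x\<^sup>2) \<partial>std_normal_distribution) = 1 / sqrt (1 + 2 * s)"
    by (simp add: \<sigma>_def)
qed

abbreviation std_gauss :: "('k::finite \<Rightarrow> real) measure" where
  "std_gauss \<equiv> PiM UNIV (\<lambda>_. std_normal_distribution)"

interpretation std_normal: prob_space std_normal_distribution
  by (rule prob_space_normal_density) simp

lemma prob_space_std_gauss: "prob_space std_gauss"
  by (rule prob_space_PiM) unfold_locales

lemma std_gauss_exp_square:
  assumes "s > - (1 / 2)"
  shows "integrable (std_gauss :: ('k::finite \<Rightarrow> real) measure) (\<lambda>g. exp (- s * (\<Sum>j\<in>UNIV. (g j)\<^sup>2)))"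
    and "(\<integral>g. exp (- s * (\<Sum>j\<in>UNIV. (g j)\<^sup>2)) \<partial>(std_gauss :: ('k::finite \<Rightarrow> real) measure)) = (1 / sqrt (1 + 2 * s)) ^ CARD('k)"
proof -
  interpret product_sigma_finite "\<lambda>_::'k. std_normal_distribution"
    by unfold_locales
  have eq: "exp (- s * (\<Sum>j\<in>UNIV. (g j)\<^sup>2)) = (\<Prod>j\<in>UNIV. exp (- s * (g j)\<^sup>2))" for g :: "'k \<Rightarrow> real"
    by (simp add: sum_distrib_left exp_sum)
  show "integrable (std_gauss :: ('k::finite \<Rightarrow> real) measure) (\<lambda>g. exp (- s * (\<Sum>j\<in>UNIV. (g j)\<^sup>2)))"
    unfolding eq by (intro product_integrable_prod std_normal_exp_square assms) simp
  have "(\<integral>g. exp (- s * (\<Sum>j\<in>UNIV. (g j)\<^sup>2)) \<partial>(std_gauss :: ('k::finite \<Rightarrow> real) measure))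
      = (\<Prod>j\<in>(UNIV::'k set). \<integral>x. exp (- s * x\<^sup>2) \<partial>std_normal_distribution)"
    unfolding eq by (intro product_integral_prod std_normal_exp_square assms) simp
  also have "\<dots> = (1 / sqrt (1 + 2 * s)) ^ CARD('k)"
    unfolding std_normal_exp_square(2)[OF assms] by simp
  finally show "(\<integral>g. exp (- s * (\<Sum>j\<in>UNIV. (g j)\<^sup>2)) \<partial>(std_gauss :: ('k::finite \<Rightarrow> real) measure)) = (1 / sqrt (1 + 2 * s)) ^ CARD('k)" .
qed

text \<open>The Gaussian is its own Fourier transform in each coordinate, and the coordinates are
  independent.\<close>

lemma exp_minus_half_square_eq:
  fixes v :: "'k::finite \<Rightarrow> real"
  shows "of_real (exp (- (\<Sum>j\<in>UNIV. (v j)\<^sup>2) / 2)) = (\<integral>g. iexp (\<Sum>j\<in>UNIV. v j * g j) \<partial>std_gauss)"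
proof -
  interpret product_sigma_finite "\<lambda>_::'k. std_normal_distribution"
    by unfold_locales
  have "of_real (exp (- (\<Sum>j\<in>UNIV. (v j)\<^sup>2) / 2)) = (\<Prod>j\<in>UNIV. char std_normal_distribution (v j))"
    by (simp add: char_std_normal_distribution sum_divide_distrib exp_sum flip: of_real_prod sum_negf)
  also have "\<dots> = (\<integral>g. (\<Prod>j\<in>UNIV. iexp (v j * g j)) \<partial>std_gauss)"
    unfolding char_def
    by (intro product_integral_prod[symmetric] std_normal.integrable_iexp) auto
  also have "\<dots> = (\<integral>g. iexp (\<Sum>j\<in>UNIV. v j * g j) \<partial>std_gauss)"
    by (simp add: sum_distrib_left exp_sum)
  finally show ?thesis .
qed

lemma iexp_sum_add: "finite I \<Longrightarrow> iexp ((\<Sum>i\<in>I. f i) + c) = (\<Prod>i\<in>I. iexp (f i)) * iexp c"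
  by (simp add: distrib_left exp_add sum_distrib_left exp_sum)

text \<open>A smooth form of Esseen's inequality: the indicator of a ball is dominated by a Gaussian,
  which is itself an average of characters.\<close>

lemma (in real_distribution) small_ball_le_char:
  fixes w :: "'i \<Rightarrow> 'k::finite \<Rightarrow> real" and a :: "'k \<Rightarrow> real"
  assumes "finite I" "\<delta> > 0"
  shows "measure (PiM I (\<lambda>_. M)) {\<omega> \<in> space (PiM I (\<lambda>_. M)). (\<Sum>j\<in>UNIV. ((\<Sum>i\<in>I. \<omega> i * w i j) - a j)\<^sup>2) < \<delta>\<^sup>2}
    \<le> exp (1 / 2) * (\<integral>g. (\<Prod>i\<in>I. cmod (char M (\<Sum>j\<in>UNIV. w i j * g j / \<delta>))) \<partial>std_gauss)"
    (is "measure ?P ?A \<le> _ * (\<integral>g. ?h g \<partial>_)")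
proof -
  let ?Q = "std_gauss :: ('k \<Rightarrow> real) measure"
  interpret P: prob_space ?P by (rule prob_space_PiM) unfold_locales
  interpret Q: prob_space ?Q by (rule prob_space_std_gauss)
  interpret PQ: pair_prob_space ?P ?Q ..
  interpret prodM: product_sigma_finite "\<lambda>_::'i. M" by unfold_locales
  have [measurable_cong]: "sets M = sets borel" by simp
  \<comment> \<open>The displacement from the centre in units of \<open>\<delta>\<close>: on the
    event its squared length is below 1, so \<open>exp (1 / 2) * \<Phi>\<close> dominates the
    indicator.\<close>
  define v where "v = (\<lambda>\<omega> j. ((\<Sum>i\<in>I. \<omega> i * w i j) - a j) / \<delta>)"
  define \<Phi> where "\<Phi> = (\<lambda>\<omega>. exp (- (\<Sum>j\<in>UNIV. (v \<omega> j)\<^sup>2) / 2))"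
  define Z where "Z = (\<lambda>\<omega> g. iexp (\<Sum>j\<in>UNIV. v \<omega> j * g j))"
  have v_meas [measurable]: "(\<lambda>\<omega>. v \<omega> j) \<in> borel_measurable ?P" for j
    unfolding v_def by measurable
  have \<Phi>_int: "integrable ?P \<Phi>"
    unfolding \<Phi>_def by (intro P.integrable_const_bound[where B = 1]) (auto intro!: sum_nonneg)
  have A_meas: "?A \<in> sets ?P"
    by measurable
  have "measure ?P ?A = (\<integral>\<omega>. indicator ?A \<omega> \<partial>?P)"
    using A_meas by simp
  also have "\<dots> \<le> (\<integral>\<omega>. exp (1 / 2) * \<Phi> \<omega> \<partial>?P)"
  proof (rule integral_mono)
    show "integrable ?P (\<lambda>\<omega>. exp (1 / 2) * \<Phi> \<omega>)"
      using \<Phi>_int by simp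
    show "integrable ?P (indicator ?A :: _ \<Rightarrow> real)"
      using A_meas by (simp add: integrable_indicator_iff P.emeasure_eq_measure)
    fix \<omega>
    have "1 \<le> exp (1 / 2) * \<Phi> \<omega>" if "\<omega> \<in> ?A"
    proof -
      have "(\<Sum>j\<in>UNIV. (v \<omega> j)\<^sup>2) = (\<Sum>j\<in>UNIV. ((\<Sum>i\<in>I. \<omega> i * w i j) - a j)\<^sup>2) / \<delta>\<^sup>2"
        by (simp add: v_def power_divide sum_divide_distrib)
      also have "\<dots> \<le> 1"
        using that \<open>\<delta> > 0\<close> by simp
      finally show ?thesis
        unfolding \<Phi>_def exp_add[symmetric] by simp
    qed
    then show "indicator ?A \<omega> \<le> exp (1 / 2) * \<Phi> \<omega>"
      by (cases "\<omega> \<in> ?A") (auto simp: \<Phi>_def)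
  qed
  also have "\<dots> = exp (1 / 2) * (\<integral>\<omega>. \<Phi> \<omega> \<partial>?P)"
    by simp
  also have "(\<integral>\<omega>. \<Phi> \<omega> \<partial>?P) \<le> (\<integral>g. ?h g \<partial>?Q)"
  proof -
    have Z_int: "integrable (?P \<Otimes>\<^sub>M ?Q) (\<lambda>(\<omega>, g). Z \<omega> g)"
      unfolding Z_def by (intro PQ.integrable_const_bound[where B = 1]) auto
    \<comment> \<open>For fixed \<open>g\<close> independence factorises the mean over
      \<open>\<omega>\<close>, and the centre enters only through a phase; taking norms makes the
      bound uniform in \<open>a\<close>.\<close>
    have inner: "(\<integral>\<omega>. Z \<omega> g \<partial>?P) =
        (\<Prod>i\<in>I. char M (\<Sum>j\<in>UNIV. w i j * g j / \<delta>)) * iexp (- (\<Sum>j\<in>UNIV. a j * g j / \<delta>))" for g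
    proof -
      have "(\<Sum>j\<in>UNIV. v \<omega> j * g j) = (\<Sum>i\<in>I. (\<Sum>j\<in>UNIV. w i j * g j / \<delta>) * \<omega> i) + - (\<Sum>j\<in>UNIV. a j * g j / \<delta>)" for \<omega>
      proof -
        have "(\<Sum>j\<in>UNIV. v \<omega> j * g j) = (\<Sum>j\<in>UNIV. \<Sum>i\<in>I. w i j * g j / \<delta> * \<omega> i) - (\<Sum>j\<in>UNIV. a j * g j / \<delta>)"
        proof -
          have "(\<Sum>i\<in>I. w i j * g j / \<delta> * \<omega> i) = (\<Sum>i\<in>I. \<omega> i * w i j) * (g j / \<delta>)" for j
            unfolding sum_distrib_right by (intro sum.cong refl) simp
          then show ?thesis
            unfolding v_def sum_subtractf[symmetric]
            by (intro sum.cong refl) (simp add: diff_divide_distrib left_diff_distrib)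
        qed
        also have "(\<Sum>j\<in>UNIV. \<Sum>i\<in>I. w i j * g j / \<delta> * \<omega> i) = (\<Sum>i\<in>I. (\<Sum>j\<in>UNIV. w i j * g j / \<delta>) * \<omega> i)"
          unfolding sum_distrib_right by (rule sum.swap)
        finally show ?thesis by simp
      qed
      then have "Z \<omega> g = (\<Prod>i\<in>I. iexp ((\<Sum>j\<in>UNIV. w i j * g j / \<delta>) * \<omega> i)) * iexp (- (\<Sum>j\<in>UNIV. a j * g j / \<delta>))" for \<omega>
        unfolding Z_def using iexp_sum_add[OF \<open>finite I\<close>] by presburger
      then have "(\<integral>\<omega>. Z \<omega> g \<partial>?P) = (\<integral>\<omega>. (\<Prod>i\<in>I. iexp ((\<Sum>j\<in>UNIV. w i j * g j / \<delta>) * \<omega> i)) \<partial>?P) * iexp (- (\<Sum>j\<in>UNIV. a j * g j / \<delta>))"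
        by simp
      also have "(\<integral>\<omega>. (\<Prod>i\<in>I. iexp ((\<Sum>j\<in>UNIV. w i j * g j / \<delta>) * \<omega> i)) \<partial>?P) = (\<Prod>i\<in>I. char M (\<Sum>j\<in>UNIV. w i j * g j / \<delta>))"
        unfolding char_def using \<open>finite I\<close>
        by (intro prodM.product_integral_prod integrable_iexp) auto
      finally show ?thesis .
    qed
    have "complex_of_real (\<integral>\<omega>. \<Phi> \<omega> \<partial>?P) = (\<integral>\<omega>. of_real (\<Phi> \<omega>) \<partial>?P)"
      by simp
    also have "\<dots> = (\<integral>\<omega>. \<integral>g. Z \<omega> g \<partial>?Q \<partial>?P)"
      unfolding \<Phi>_def Z_def exp_minus_half_square_eq ..
    also have "\<dots> = (\<integral>g. \<integral>\<omega>. Z \<omega> g \<partial>?P \<partial>?Q)"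
      by (rule PQ.Fubini_integral[OF Z_int, symmetric])
    finally have "cmod (complex_of_real (\<integral>\<omega>. \<Phi> \<omega> \<partial>?P)) = cmod (\<integral>g. \<integral>\<omega>. Z \<omega> g \<partial>?P \<partial>?Q)"
      by (rule arg_cong)
    moreover have "0 \<le> (\<integral>\<omega>. \<Phi> \<omega> \<partial>?P)"
      by (rule Bochner_Integration.integral_nonneg) (simp add: \<Phi>_def)
    ultimately have "(\<integral>\<omega>. \<Phi> \<omega> \<partial>?P) = cmod (\<integral>g. \<integral>\<omega>. Z \<omega> g \<partial>?P \<partial>?Q)"
      by (simp only: norm_of_real abs_of_nonneg)
    also have "\<dots> \<le> (\<integral>g. cmod (\<integral>\<omega>. Z \<omega> g \<partial>?P) \<partial>?Q)"
      by (rule integral_norm_bound)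
    also have "\<dots> = (\<integral>g. ?h g \<partial>?Q)"
      unfolding inner by (simp add: norm_mult prod_norm)
    finally show ?thesis .
  qed
  finally show ?thesis by simp
qed

text \<open>The exponential of the minimum is at most the sum of two exponentials. Outside the ball
  of radius \<open>M\<close> the factor \<open>exp (n / 4 - M^2 / 4)\<close>, with \<open>n\<close>
  the squared length of \<open>g\<close>, is at least 1 and has a finite mean.\<close>

lemma gauss_average_le:
  fixes c \<delta> M :: real and F :: "('k::finite \<Rightarrow> real) \<Rightarrow> real"
  assumes "c > 0" "\<delta> > 0"
    and "\<And>g. (\<Sum>j\<in>UNIV. (g j)\<^sup>2) \<le> M\<^sup>2 \<Longrightarrow> F g \<le> exp (- c / 2 * min ((\<Sum>j\<in>UNIV. (g j)\<^sup>2) / \<delta>\<^sup>2) M)"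
    and "\<And>g. F g \<le> 1"
  shows "(\<integral>g. F g \<partial>std_gauss) \<le> (1 / sqrt (1 + c / \<delta>\<^sup>2)) ^ CARD('k) + exp (- c * M / 2) + sqrt 2 ^ CARD('k) * exp (- M\<^sup>2 / 4)"
proof -
  let ?Q = "std_gauss :: ('k \<Rightarrow> real) measure"
  interpret Q: prob_space ?Q by (rule prob_space_std_gauss)
  define s where "s = c / (2 * \<delta>\<^sup>2)"
  have s: "s > - (1 / 2)" "- (1 / 4) > - (1 / 2 :: real)"
    using assms(1,2) by (simp_all add: s_def less_le_trans[of _ 0])
  let ?n = "\<lambda>g::'k \<Rightarrow> real. \<Sum>j\<in>UNIV. (g j)\<^sup>2"
  let ?B = "\<lambda>g. exp (- s * ?n g) + exp (- c * M / 2) + exp (- (- (1 / 4)) * ?n g) * exp (- M\<^sup>2 / 4)"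
  note int = std_gauss_exp_square(1)[OF s(1)] std_gauss_exp_square(1)[OF s(2)]
  have "(\<integral>g. F g \<partial>?Q) \<le> (\<integral>g. ?B g \<partial>?Q)"
  \<comment> \<open>Integrability is shown for the majorant alone: a non-integrable \<open>F\<close>
    has integral 0 by convention, and the majorant is nonnegative.\<close>
  proof (rule integral_mono')
    show "integrable ?Q ?B"
      by (intro Bochner_Integration.integrable_add integrable_mult_left Q.integrable_const int)
    fix g :: "'k \<Rightarrow> real"
    show "0 \<le> ?B g" by (intro add_nonneg_nonneg mult_nonneg_nonneg) auto
    show "F g \<le> ?B g"
    proof (cases "?n g \<le> M\<^sup>2")
      case True
      have "exp (- c / 2 * min (?n g / \<delta>\<^sup>2) M) \<le> exp (- s * ?n g) + exp (- c * M / 2)"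
        by (cases "?n g / \<delta>\<^sup>2 \<le> M") (simp_all add: s_def min_def)
      moreover have "0 \<le> exp (- (- (1 / 4)) * ?n g) * exp (- M\<^sup>2 / 4)" by simp
      ultimately show ?thesis using assms(3)[OF True] by linarith
    next
      case False
      then have "1 \<le> exp (- (- (1 / 4)) * ?n g) * exp (- M\<^sup>2 / 4)"
        unfolding exp_add[symmetric] by simp
      moreover have "0 \<le> exp (- s * ?n g)" "0 \<le> exp (- c * M / 2)" by simp_all
      ultimately show ?thesis using assms(4)[of g] by linarith
    qed
  qed
  also have "\<dots> = (\<integral>g. exp (- s * ?n g) \<partial>?Q) + exp (- c * M / 2) + (\<integral>g. exp (- (- (1 / 4)) * ?n g) \<partial>?Q) * exp (- M\<^sup>2 / 4)"
  proof -
    have "(\<integral>g. ?B g \<partial>?Q) = (\<integral>g. exp (- s * ?n g) + exp (- c * M / 2) \<partial>?Q) + (\<integral>g. exp (- (- (1 / 4)) * ?n g) * exp (- M\<^sup>2 / 4) \<partial>?Q)"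
      by (intro Bochner_Integration.integral_add Bochner_Integration.integrable_add integrable_mult_left Q.integrable_const int)
    also have "(\<integral>g. exp (- s * ?n g) + exp (- c * M / 2) \<partial>?Q) = (\<integral>g. exp (- s * ?n g) \<partial>?Q) + (\<integral>g. exp (- c * M / 2) \<partial>?Q)"
      by (intro Bochner_Integration.integral_add Q.integrable_const int)
    also have "(\<integral>g. exp (- c * M / 2) \<partial>?Q) = exp (- c * M / 2)"
      by (simp add: Q.prob_space)
    also have "(\<integral>g. exp (- (- (1 / 4)) * ?n g) * exp (- M\<^sup>2 / 4) \<partial>?Q) = (\<integral>g. exp (- (- (1 / 4)) * ?n g) \<partial>?Q) * exp (- M\<^sup>2 / 4)"
      by (rule integral_mult_left_zero)
    finally show ?thesis .
  qed
  also have "\<dots> = (1 / sqrt (1 + c / \<delta>\<^sup>2)) ^ CARD('k) + exp (- c * M / 2) + sqrt 2 ^ CARD('k) * exp (- M\<^sup>2 / 4)"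
    unfolding std_gauss_exp_square(2)[OF s(1)] std_gauss_exp_square(2)[OF s(2)]
    by (simp add: s_def real_sqrt_divide)
  finally show ?thesis .
qed

section \<open>Application to the coefficient vectors\<close>

lemma vector_4_nth:
  "(vector [a, b, c, d] :: real ^ 4) $ 1 = a" "(vector [a, b, c, d] :: real ^ 4) $ 2 = b"
  "(vector [a, b, c, d] :: real ^ 4) $ 3 = c" "(vector [a, b, c, d] :: real ^ 4) $ 4 = d"
  unfolding vector_def by simp_all

lemma Sn_ball_iff:
  assumes "M > 0" "\<delta> > 0"
  shows "(1 / sqrt M) *\<^sub>R Sn M n x y \<omega> \<in> ball a \<delta> \<longleftrightarrow>
    (\<Sum>j\<in>UNIV. ((\<Sum>i=1..n. \<omega> i * ((vector [bfun M i x, cfun M i x, bfun M i y, cfun M i y] :: real ^ 4) $ j / sqrt M)) - a $ j)\<^sup>2) < \<delta>\<^sup>2"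
proof -
  let ?v = "(1 / sqrt M) *\<^sub>R Sn M n x y \<omega>"
  have "?v $ j = (\<Sum>i=1..n. \<omega> i * ((vector [bfun M i x, cfun M i x, bfun M i y, cfun M i y] :: real ^ 4) $ j / sqrt M))" for j
    by (simp add: Sn_def sum_divide_distrib)
  moreover have "?v \<in> ball a \<delta> \<longleftrightarrow> (norm (?v - a))\<^sup>2 < \<delta>\<^sup>2"
  proof -
    have "?v \<in> ball a \<delta> \<longleftrightarrow> norm (?v - a) < \<delta>"
      by (simp add: dist_norm norm_minus_commute)
    also have "\<dots> \<longleftrightarrow> (norm (?v - a))\<^sup>2 < \<delta>\<^sup>2"
      using \<open>\<delta> > 0\<close> power2_less_imp_less[of "norm (?v - a)" \<delta>] power_strict_mono[of "norm (?v - a)" \<delta> 2]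
      by auto
    finally show ?thesis .
  qed
  moreover have "(norm (?v - a))\<^sup>2 = (\<Sum>j\<in>UNIV. (?v $ j - a $ j)\<^sup>2)"
    by (simp add: norm_vec_def L2_set_def sum_nonneg)
  ultimately show ?thesis by simp
qed

lemma linear_form_eq_window_terms:
  assumes "M > 0" "x > 0" "y > 0"
  shows "(\<Sum>j\<in>UNIV. (vector [bfun M i x, cfun M i x, bfun M i y, cfun M i y] :: real ^ 4) $ j / sqrt M * g j / \<delta>)
    = window_term x (g 1 / \<delta>) (g 2 / \<delta>) (real i) + window_term y (g 3 / \<delta>) (g 4 / \<delta>) (real i)"
proof -
  have b: "bfun M i z / sqrt M = poisson_root z (real i)" if "z > 0" for z
    using assms(1) that by (simp add: bfun_def poisson_root_nat)
  have c: "cfun M i z / sqrt M = poisson_root z (real i) * ((real i - z\<^sup>2) / z)" if "z > 0" for z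
    using assms(1) that by (simp add: cfun_def poisson_root_nat mult_ac)
  show ?thesis
    unfolding sum_4 vector_4_nth b[OF assms(2)] b[OF assms(3)] c[OF assms(2)] c[OF assms(3)] window_term_def
    by (simp add: distrib_left mult_ac)
qed

theorem theorem4p3:
  fixes C \<epsilon>g c1 c2 :: real and \<mu> :: "real measure"
  assumes "C > 0" and "0 < \<epsilon>g" and "\<epsilon>g < 1/2"
    and "0 < c1" and "c1 < c2"
    and "prob_space \<mu>" and "sets \<mu> = sets borel"
    and "subgaussian \<mu>"
    and "integrable \<mu> (\<lambda>z. z)" and "(\<integral>z. z \<partial>\<mu>) = 0"
    and "integrable \<mu> (\<lambda>z. z^2)" and "(\<integral>z. z^2 \<partial>\<mu>) = 1"
  shows "\<exists>K n0 M0. \<forall>(n::nat) (M::real) x y (a :: real ^ 4).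
     n \<ge> n0 \<and> M \<ge> M0 \<and> c2 * M \<le> sqrt (real n) - M
     \<and> x \<in> {c1 * M .. c2 * M} \<and> y \<in> {c1 * M .. c2 * M} \<and> \<bar>x - y\<bar> \<ge> M powr \<epsilon>g
     \<longrightarrow> measure (PiM {1..n} (\<lambda>_. \<mu>))
           {\<omega> \<in> space (PiM {1..n} (\<lambda>_. \<mu>)).
              (1 / sqrt M) *\<^sub>R Sn M n x y \<omega> \<in> ball a (M powr (- C))}
         \<le> K * (M powr (- C)) ^ 4"
proof -
  interpret prob_space \<mu> by fact
  interpret real_distribution \<mu>
    by unfold_locales (use assms(7) sets_eq_imp_space_eq[OF assms(7)] in auto)
  obtain s0 where s0: "s0 > 0" "\<And>s. \<bar>s\<bar> \<le> s0 \<Longrightarrow> s\<^sup>2 / 4 \<le> sym_char_defect \<mu> s"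
    using sym_char_defect_ge_quadratic assms(9-12) by blast
  \<comment> \<open>The frequencies are \<open>g / \<delta>\<close> with \<open>g\<close> of length
    at most \<open>M\<close> and \<open>\<delta> = M powr - C\<close>, hence of size up to
    \<open>M powr (C + 1)\<close>; this is the exponent passed on.\<close>
  have quad: "\<And>s. \<bar>s\<bar> \<le> s0 \<Longrightarrow> 1 / 4 * s\<^sup>2 \<le> sym_char_defect \<mu> s" and "0 < C + 1" "(0::real) < 1 / 4"
    using s0(2) \<open>C > 0\<close> by auto
  show ?thesis
  proof (rule exponent_lower[OF sym_char_defect_nonneg sym_char_defect_diff_le quad s0(1) \<open>0 < 1 / 4\<close> \<open>0 < C + 1\<close> assms(4,5,2)])
    fix c M1 :: real
    assume "c > 0" "M1 \<ge> 1" and lower: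
      "\<And>M (n::nat) x y p q p' q'. M \<ge> M1 \<Longrightarrow> c2 * M \<le> sqrt n - M \<Longrightarrow> x \<in> {c1 * M..c2 * M} \<Longrightarrow> y \<in> {c1 * M..c2 * M} \<Longrightarrow>
        \<bar>x - y\<bar> \<ge> M powr \<epsilon>g \<Longrightarrow> p\<^sup>2 + q\<^sup>2 + p'\<^sup>2 + q'\<^sup>2 \<le> (M powr (C + 1))\<^sup>2 \<Longrightarrow>
        c * min (p\<^sup>2 + q\<^sup>2 + p'\<^sup>2 + q'\<^sup>2) M \<le> (\<Sum>i=1..n. sym_char_defect \<mu> (window_term x p q (real i) + window_term y p' q' (real i)))"
    have "\<forall>\<^sub>F M in at_top. exp (- c * M / 2) \<le> (M powr - C) ^ 4 \<and> 4 * exp (- M\<^sup>2 / 4) \<le> (M powr - C) ^ 4"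
      using eventually_exp_le_powr[OF \<open>c > 0\<close> \<open>C > 0\<close>] by (rule eventually_conj)
    then obtain M2 where M2: "\<And>M. M \<ge> M2 \<Longrightarrow> exp (- c * M / 2) \<le> (M powr - C) ^ 4"
      "\<And>M. M \<ge> M2 \<Longrightarrow> 4 * exp (- M\<^sup>2 / 4) \<le> (M powr - C) ^ 4"
      unfolding eventually_at_top_linorder by blast
    show ?thesis
    \<comment> \<open>The factor \<open>exp (1 / 2)\<close> comes from the Gaussian majorant. The
      bulk contributes \<open>1 / (1 + c / \<delta>^2)^2 <= \<delta> ^ 4 / c^2\<close>, and each of
      the two tails at most \<open>\<delta> ^ 4\<close>.\<close>
    proof (rule exI[of _ "exp (1 / 2) * (1 / c\<^sup>2 + 2)"], rule exI[of _ "0::nat"], rule exI[of _ "max M1 M2"],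
        intro allI impI, elim conjE)
      fix n :: nat and M x y :: real and a :: "real ^ 4"
      assume "0 \<le> n" "M \<ge> max M1 M2" and n: "c2 * M \<le> sqrt (real n) - M"
        and x: "x \<in> {c1 * M .. c2 * M}" and y: "y \<in> {c1 * M .. c2 * M}" and sep: "\<bar>x - y\<bar> \<ge> M powr \<epsilon>g"
      define \<delta> where "\<delta> = M powr - C"
      have M: "M \<ge> M1" "M \<ge> M2" "M \<ge> 1" "M > 0" using \<open>M \<ge> max M1 M2\<close> \<open>M1 \<ge> 1\<close> by auto
      then have "\<delta> > 0" "0 < c1 * M" using \<open>0 < c1\<close> by (simp_all add: \<delta>_def)
      then have "x > 0" "y > 0" using x y unfolding atLeastAtMost_iff by linarith+
      let ?w = "\<lambda>i j. (vector [bfun M i x, cfun M i x, bfun M i y, cfun M i y] :: real ^ 4) $ j / sqrt M"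
      let ?F = "\<lambda>g. \<Prod>i=1..n. cmod (char \<mu> (\<Sum>j\<in>UNIV. ?w i j * g j / \<delta>))"
      have "measure (PiM {1..n} (\<lambda>_. \<mu>)) {\<omega> \<in> space (PiM {1..n} (\<lambda>_. \<mu>)). (1 / sqrt M) *\<^sub>R Sn M n x y \<omega> \<in> ball a \<delta>}
          \<le> exp (1 / 2) * (\<integral>g. ?F g \<partial>std_gauss)"
        unfolding Sn_ball_iff[OF \<open>M > 0\<close> \<open>\<delta> > 0\<close>] by (rule small_ball_le_char[OF finite_atLeastAtMost \<open>\<delta> > 0\<close>])
      also have "(\<integral>g. ?F g \<partial>std_gauss) \<le> (1 / sqrt (1 + c / \<delta>\<^sup>2)) ^ CARD(4) + exp (- c * M / 2) + sqrt 2 ^ CARD(4) * exp (- M\<^sup>2 / 4)"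
      proof (rule gauss_average_le[OF \<open>c > 0\<close> \<open>\<delta> > 0\<close>])
        fix g :: "4 \<Rightarrow> real"
        show "?F g \<le> 1"
          by (intro prod_le_1) (simp add: cmod_char_le_1)
        assume g: "(\<Sum>j\<in>UNIV. (g j)\<^sup>2) \<le> M\<^sup>2"
        let ?D = "\<Sum>i=1..n. sym_char_defect \<mu> (\<Sum>j\<in>UNIV. ?w i j * g j / \<delta>)"
        have norm_eq: "(g 1 / \<delta>)\<^sup>2 + (g 2 / \<delta>)\<^sup>2 + (g 3 / \<delta>)\<^sup>2 + (g 4 / \<delta>)\<^sup>2 = (\<Sum>j\<in>UNIV. (g j)\<^sup>2) / \<delta>\<^sup>2"
          by (simp add: sum_4 power_divide add_divide_distrib)
        have "M / \<delta> = M powr (C + 1)"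
          using \<open>M > 0\<close> by (simp add: \<delta>_def powr_minus powr_add field_simps)
        then have "(\<Sum>j\<in>UNIV. (g j)\<^sup>2) / \<delta>\<^sup>2 \<le> (M powr (C + 1))\<^sup>2"
          using g divide_right_mono[OF g, of "\<delta>\<^sup>2"] by (simp add: power_divide[symmetric])
        from lower[OF M(1) n x y sep, of "g 1 / \<delta>" "g 2 / \<delta>" "g 3 / \<delta>" "g 4 / \<delta>", unfolded norm_eq, OF this]
        have "c * min ((\<Sum>j\<in>UNIV. (g j)\<^sup>2) / \<delta>\<^sup>2) M \<le> ?D"
          unfolding linear_form_eq_window_terms[OF \<open>M > 0\<close> \<open>x > 0\<close> \<open>y > 0\<close>] .
        have "?F g \<le> (\<Prod>i=1..n. exp (- sym_char_defect \<mu> (\<Sum>j\<in>UNIV. ?w i j * g j / \<delta>) / 2))"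
          by (intro prod_mono conjI norm_ge_zero cmod_char_le_exp)
        also have "\<dots> = exp (- ?D / 2)"
          unfolding exp_sum[OF finite_atLeastAtMost, symmetric] by (simp add: sum_negf sum_divide_distrib)
        also have "\<dots> \<le> exp (- c / 2 * min ((\<Sum>j\<in>UNIV. (g j)\<^sup>2) / \<delta>\<^sup>2) M)"
          using \<open>c * min _ M \<le> ?D\<close> by simp
        finally show "?F g \<le> exp (- c / 2 * min ((\<Sum>j\<in>UNIV. (g j)\<^sup>2) / \<delta>\<^sup>2) M)" .
      qed
      also have "\<dots> \<le> (1 / c\<^sup>2 + 2) * \<delta> ^ 4"
      proof -
        have four: "sqrt v ^ 4 = v\<^sup>2" if "v \<ge> 0" for v
          using that power_mult[of "sqrt v" 2 2] by simp
        have "0 < c / \<delta>\<^sup>2" using \<open>c > 0\<close> \<open>\<delta> > 0\<close> by simp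
        then have pos: "0 < 1 + c / \<delta>\<^sup>2" by linarith
        then have "(1 / sqrt (1 + c / \<delta>\<^sup>2)) ^ 4 = 1 / (1 + c / \<delta>\<^sup>2)\<^sup>2"
          using pos by (simp add: power_divide four)
        also have "\<dots> \<le> 1 / (c / \<delta>\<^sup>2)\<^sup>2"
          using pos \<open>0 < c / \<delta>\<^sup>2\<close> by (intro divide_left_mono power_mono mult_pos_pos zero_less_power) auto
        also have "\<dots> = 1 / c\<^sup>2 * \<delta> ^ 4"
          by (simp add: power_divide flip: power_mult)
        finally show ?thesis
          using M2[OF M(2)] four[of 2] by (simp add: \<delta>_def distrib_right)
      qed
      finally show "measure (PiM {1..n} (\<lambda>_. \<mu>)) {\<omega> \<in> space (PiM {1..n} (\<lambda>_. \<mu>)). (1 / sqrt M) *\<^sub>R Sn M n x y \<omega> \<in> ball a (M powr (- C))}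
          \<le> exp (1 / 2) * (1 / c\<^sup>2 + 2) * (M powr (- C)) ^ 4"
        by (simp add: \<delta>_def mult_ac)
    qed
  qed
qed

end
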